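(* Let $\mathcal N$ be a signed nonlinear network with $n$ nodes partitioned into $n_B$ boundary and $n_C$ central nodes, $m$ edges, a single negative conductance $I_{l_-}=-k\,g_-(y_{l_-})$ on an edge $l_-$ between nodes $i$ and $j$, and with all other edges linear with fixed positive conductances $R_l^{-1}$. Assume that the graph obtained by removing $l_-$, with Laplacian $L_+$, is connected, let $r_{ij}=v_i-v_j$ with $L_+v=e_{ij}$, $v\in\mathbf 1_n^\perp$, and assume that $\frac{\partial^2K}{\partial z_C^2}$ is invertible at $z=0$, $k=r_{ij}^{-1}$. Let $k=\lambda$ be the bifurcation parameter of the nonlinear behavior of $\mathcal N$ (with $u_B=0$). If $g_-''(0)\neq0$, then the input-output terminal behavior of $\mathcal N$ undergoes at $(x,u_B,k)=(0,0,r_{ij}^{-1})$ a transcritical bifurcation. If $g_-''(0)=0$ and $g_-'''(0)\ne0$, then the bifurcation at $(x,u_B,k)=(0,0,r_{ij}^{-1})$ is a pitchfork; furthermore, the pitchfork is supercritical if $g_-'''(0)<0$ and subcritical if $g_-'''(0)>0$. Finally, if $g_-''(0)=g_-'''(0)=0$, then $\mathcal N$ undergoes at $(x,u_B,k)=(0,0,r_{ij}^{-1})$ a bifurcation of codimension $>2$.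
   Context: Network. The network is a graph with incidence matrix $D\in\mathbb{R}^{n\times m}$, node potentials $z\in\mathbb{R}^n$ and edge voltages $y=D^\top z$, with $y_{l_-}=z_i-z_j$. The negative edge has current $I_{l_-}=-k\frac{\partial G_{l_-}}{\partial y_{l_-}}(y_{l_-})$, where $G_{l_-}$ is convex and smooth, $k>0$ is a tunable gain, $g_-(y)=\frac{\partial G_{l_-}}{\partial y}(y)$, with $g_-(0)=0$ and $g_-'(0)=1$. For $l\neq l_-$ the edge potential is $\frac12R_l^{-1}y_l^2$, $R_l>0$. Thus $K(z,k)=\sum_{l\ne l_-}\frac12R_l^{-1}y_l^2-kG_{l_-}(y_{l_-})$ with $y=D^\top z$. With $z=(z_B,z_C)$, $u=(u_B,u_C)$, $u_C=0$, the network equations are $0=F(z,u,k)=\frac{\partial K}{\partial z}(z,k)-u$. $e_{ij}\in\mathbb{R}^n$ has $1$ at position $i$, $-1$ at position $j$, zero elsewhere; $\mathbf 1_n$ is the all-ones vector. Lyapunov-Schmidt reduction. By shift invariance the equations are restricted to $z,u\in\mathbf 1_n^\perp$, with $F$ taking values in $\mathbf 1_n^\perp$. Let $L=\frac{\partial^2K}{\partial z^2}(0,r_{ij}^{-1})$, restricted to $\mathbf 1_n^\perp$; its kernel is spanned by $v$. Let $E$ be the orthogonal projection of $\mathbf 1_n^\perp$ onto $\operatorname{im}L$. Near $(0,0,r_{ij}^{-1})$, $W(x,u_B,k)\in\operatorname{im}L$ is the implicit function with $W(0,0,r_{ij}^{-1})=0$ and $E\,F(xv+W(x,u_B,k),(u_B,0),k)\equiv0$,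 and $f(x,u_B,k)=v^\top F(xv+W(x,u_B,k),(u_B,0),k)$. The bifurcation of the terminal behavior with parameter $\lambda=k$ is the bifurcation problem $f(x,0,\lambda)=0$ near $(x,\lambda)=(0,r_{ij}^{-1})$. Bifurcation terminology (Golubitsky–Schaeffer). Put $\mu=\lambda-r_{ij}^{-1}$ and $h(x,\mu)=f(x,0,r_{ij}^{-1}+\mu)$, a smooth germ at $(0,0)$. Two germs $h,q$ are equivalent if $h(x,\mu)=S(x,\mu)\,q(X(x,\mu),\Lambda(\mu))$ near $0$ with $S$, $X$, $\Lambda$ smooth, $X(0,0)=0$, $\Lambda(0)=0$, $S>0$, $X_x>0$, $\Lambda'>0$. The bifurcation is transcritical if $h$ is equivalent to $\epsilon(x^2-\mu^2)$ with $\epsilon\in\{1,-1\}$, and a pitchfork if $h$ is equivalent to $\epsilon x^3+\delta\mu x$ with $\epsilon,\delta\in\{1,-1\}$. The pitchfork is supercritical if the two nontrivial solution branches exist for $\mu>0$ (i.e. $k>r_{ij}^{-1}$, the side on which the branch $z=0$ is unstable), and subcritical if they exist for $\mu<0$. The codimension of $h$ is $\dim_{\mathbb{R}}\mathcal E_{x,\mu}/T(h)\in\{0,1,2,\dots,\infty\}$, where $\mathcal E_{x,\mu}$ (resp. $\mathcal E_\mu$) is the ring of smooth germs at $0$ in $(x,\mu)$ (resp. $\mu$) and $T(h)=\{a h+b h_x+c h_\mu: a,b\in\mathcal E_{x,\mu},\ c\in\mathcal E_\mu\}$. *)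

theory Defs
  imports
    "Graph_Theory.Digraph_Component"
    "HOL-Analysis.Analysis"
    "HOL-Library.Extended_Nat"
begin

section \<open>Smooth maps and germs\<close>

primrec k_smooth_on ::
  "nat \<Rightarrow> 'a set \<Rightarrow> ('a::real_normed_vector \<Rightarrow> 'b::real_normed_vector) \<Rightarrow> bool" where
  "k_smooth_on 0 S f \<longleftrightarrow> continuous_on S f"
| "k_smooth_on (Suc n) S f \<longleftrightarrow>
     (\<forall>x\<in>S. f differentiable (at x)) \<and>
     (\<forall>d. k_smooth_on n S (\<lambda>x. frechet_derivative f (at x) d))"

text \<open>Only used for open sets and finite-dimensional domains, where this is the usual
  notion of a \<open>C\<close>-infinity map.\<close>

definition smooth_on :: "'a set \<Rightarrow> ('a::real_normed_vector \<Rightarrow> 'b::real_normed_vector) \<Rightarrow> bool" where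
  "smooth_on S f \<longleftrightarrow> (\<forall>n. k_smooth_on n S f)"

text \<open>Germs at the origin are represented by functions that are smooth near the origin;
  two representatives denote the same germ iff they agree eventually in \<open>nhds 0\<close>.\<close>

definition smooth_germ :: "('a::real_normed_vector \<Rightarrow> 'b::real_normed_vector) \<Rightarrow> bool" where
  "smooth_germ f \<longleftrightarrow> (\<exists>U. open U \<and> 0 \<in> U \<and> smooth_on U f)"

definition ddx :: "(real \<times> real \<Rightarrow> real) \<Rightarrow> real \<times> real \<Rightarrow> real" where
  "ddx h = (\<lambda>(x, \<mu>). deriv (\<lambda>t. h (t, \<mu>)) x)"

definition ddmu :: "(real \<times> real \<Rightarrow> real) \<Rightarrow> real \<times> real \<Rightarrow> real" where
  "ddmu h = (\<lambda>(x, \<mu>). deriv (\<lambda>t. h (x, t)) \<mu>)"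

section \<open>Bifurcation problems in one state variable\<close>

definition germ_equivalent ::
  "(real \<times> real \<Rightarrow> real) \<Rightarrow> (real \<times> real \<Rightarrow> real) \<Rightarrow> bool" where
  "germ_equivalent h q \<longleftrightarrow>
     (\<exists>S X :: real \<times> real \<Rightarrow> real. \<exists>\<Lambda> :: real \<Rightarrow> real.
        smooth_germ S \<and> smooth_germ X \<and> smooth_germ \<Lambda> \<and>
        X (0, 0) = 0 \<and> \<Lambda> 0 = 0 \<and>
        (\<forall>\<^sub>F p in nhds 0. h p = S p * q (X p, \<Lambda> (snd p)) \<and> S p > 0 \<and> ddx X p > 0) \<and>
        (\<forall>\<^sub>F \<mu> in nhds 0. deriv \<Lambda> \<mu> > 0))"

definition transcritical :: "(real \<times> real \<Rightarrow> real) \<Rightarrow> bool" where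
  "transcritical h \<longleftrightarrow>
     (\<exists>\<epsilon>\<in>{1, -1}. germ_equivalent h (\<lambda>(x, \<mu>). \<epsilon> * (x\<^sup>2 - \<mu>\<^sup>2)))"

definition pitchfork :: "(real \<times> real \<Rightarrow> real) \<Rightarrow> bool" where
  "pitchfork h \<longleftrightarrow>
     (\<exists>\<epsilon>\<in>{1, -1}. \<exists>\<delta>\<in>{1, -1}. germ_equivalent h (\<lambda>(x, \<mu>). \<epsilon> * x ^ 3 + \<delta> * \<mu> * x))"

text \<open>Near the origin, the zero set of \<open>h\<close> consists of the trivial branch \<open>x = 0\<close> together
  with exactly two nontrivial branches \<open>x1 < 0 < x2\<close>, which emanate from the origin and are
  defined for the parameters in \<open>side\<close> only (\<open>side\<close> is an open half-line ending at 0).\<close>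

definition nontrivial_branches_on :: "real set \<Rightarrow> (real \<times> real \<Rightarrow> real) \<Rightarrow> bool" where
  "nontrivial_branches_on side h \<longleftrightarrow>
     (\<exists>\<eta>>0. \<exists>\<delta>>0. \<exists>x1 x2 :: real \<Rightarrow> real.
        continuous_on (side \<inter> ball 0 \<eta>) x1 \<and> continuous_on (side \<inter> ball 0 \<eta>) x2 \<and>
        (x1 \<longlongrightarrow> 0) (at 0 within side) \<and> (x2 \<longlongrightarrow> 0) (at 0 within side) \<and>
        (\<forall>\<mu>\<in>side \<inter> ball 0 \<eta>. x1 \<mu> < 0 \<and> 0 < x2 \<mu>) \<and>
        (\<forall>x \<mu>. \<bar>x\<bar> < \<delta> \<and> \<bar>\<mu>\<bar> < \<eta> \<longrightarrow>
           (h (x, \<mu>) = 0 \<longleftrightarrow> x = 0 \<or> \<mu> \<in> side \<and> (x = x1 \<mu> \<or> x = x2 \<mu>))))"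

definition supercritical_pitchfork :: "(real \<times> real \<Rightarrow> real) \<Rightarrow> bool" where
  "supercritical_pitchfork h \<longleftrightarrow> pitchfork h \<and> nontrivial_branches_on {0<..} h"

definition subcritical_pitchfork :: "(real \<times> real \<Rightarrow> real) \<Rightarrow> bool" where
  "subcritical_pitchfork h \<longleftrightarrow> pitchfork h \<and> nontrivial_branches_on {..<0} h"

definition tangent_space :: "(real \<times> real \<Rightarrow> real) \<Rightarrow> (real \<times> real \<Rightarrow> real) set" where
  "tangent_space h =
     {q. \<exists>a b :: real \<times> real \<Rightarrow> real. \<exists>c :: real \<Rightarrow> real.
           smooth_germ a \<and> smooth_germ b \<and> smooth_germ c \<and>
           (\<forall>\<^sub>F p in nhds 0. q p = a p * h p + b p * ddx h p + c (snd p) * ddmu h p)}"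

text \<open>The dimension of the quotient of the space of smooth germs by \<open>tangent_space h\<close>,
  as the least number of germs whose classes span the quotient (infinite if no finite set
  does, since the infimum of the empty set is \<open>\<infinity>\<close>).\<close>

definition germ_codim :: "(real \<times> real \<Rightarrow> real) \<Rightarrow> enat" where
  "germ_codim h =
     Inf {enat (card B) | B :: (real \<times> real \<Rightarrow> real) set.
            finite B \<and> (\<forall>b\<in>B. smooth_germ b) \<and>
            (\<forall>q. smooth_germ q \<longrightarrow>
               (\<exists>c. (\<lambda>p. q p - (\<Sum>b\<in>B. c b * b p)) \<in> tangent_space h))}"

section \<open>Networks\<close>

text \<open>The orientation of an edge from tail to head only fixes the sign of its voltage.\<close>

definition incidence :: "('n::finite, 'm::finite) pre_digraph \<Rightarrow> real ^ 'm ^ 'n" where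
  "incidence N = (\<chi> p l. if p = tail N l then 1 else if p = head N l then -1 else 0)"

definition edge_voltages :: "('n::finite, 'm::finite) pre_digraph \<Rightarrow> real ^ 'n \<Rightarrow> real ^ 'm" where
  "edge_voltages N z = transpose (incidence N) *v z"

definition network_potential ::
  "('n::finite, 'm::finite) pre_digraph \<Rightarrow> 'm \<Rightarrow> ('m \<Rightarrow> real) \<Rightarrow> (real \<Rightarrow> real) \<Rightarrow>
    real ^ 'n \<Rightarrow> real \<Rightarrow> real" where
  "network_potential N neg R G z k =
     (\<Sum>l\<in>UNIV - {neg}. 1 / 2 * inverse (R l) * (edge_voltages N z $ l)\<^sup>2)
       - k * G (edge_voltages N z $ neg)"

definition laplacian_without ::
  "('n::finite, 'm::finite) pre_digraph \<Rightarrow> 'm \<Rightarrow> ('m \<Rightarrow> real) \<Rightarrow> real ^ 'n ^ 'n" where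
  "laplacian_without N neg R =
     (\<chi> p q. \<Sum>l\<in>UNIV - {neg}. inverse (R l) * incidence N $ p $ l * incidence N $ q $ l)"

definition gradient :: "(real ^ 'n::finite \<Rightarrow> real) \<Rightarrow> real ^ 'n \<Rightarrow> real ^ 'n" where
  "gradient \<phi> z = (\<chi> p. frechet_derivative \<phi> (at z) (axis p 1))"

definition hessian :: "(real ^ 'n::finite \<Rightarrow> real) \<Rightarrow> real ^ 'n \<Rightarrow> real ^ 'n ^ 'n" where
  "hessian \<phi> z = jacobian (gradient \<phi>) (at z)"

definition coordinate_subspace :: "'n set \<Rightarrow> (real ^ 'n::finite) set" where
  "coordinate_subspace C = {w. \<forall>p. p \<notin> C \<longrightarrow> w $ p = 0}"

text \<open>Invertibility of the principal block of \<open>A\<close> with rows and columns in \<open>C\<close>, acting on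
  vectors indexed by \<open>C\<close>.\<close>

definition block_invertible :: "'n set \<Rightarrow> real ^ 'n ^ 'n::finite \<Rightarrow> bool" where
  "block_invertible C A \<longleftrightarrow>
     bij_betw (\<lambda>w. \<chi> p. if p \<in> C then (A *v w) $ p else 0)
       (coordinate_subspace C) (coordinate_subspace C)"

section \<open>Lyapunov--Schmidt reduction\<close>

definition ones_perp :: "(real ^ 'n::finite) set" where
  "ones_perp = {z. orthogonal z (\<chi> p. 1)}"

definition orthogonal_projection :: "'a::real_inner set \<Rightarrow> 'a \<Rightarrow> 'a" where
  "orthogonal_projection S x = (THE p. p \<in> S \<and> (\<forall>s\<in>S. orthogonal (x - p) s))"

definition network_F ::
  "(real ^ 'n \<Rightarrow> real \<Rightarrow> real) \<Rightarrow> real ^ 'n \<Rightarrow> real ^ 'n \<Rightarrow> real \<Rightarrow> real ^ 'n::finite" where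
  "network_F K z u k = gradient (\<lambda>w. K w k) z - u"

definition linearization_image ::
  "(real ^ 'n \<Rightarrow> real \<Rightarrow> real) \<Rightarrow> real \<Rightarrow> (real ^ 'n::finite) set" where
  "linearization_image K k0 = (\<lambda>z. hessian (\<lambda>w. K w k0) 0 *v z) ` ones_perp"

text \<open>The inputs \<open>(u_B, 0)\<close> in the orthogonal complement of the all-ones vector.\<close>

definition boundary_inputs :: "'n set \<Rightarrow> (real ^ 'n::finite) set" where
  "boundary_inputs B = ones_perp \<inter> coordinate_subspace B"

text \<open>Inputs range over a proper subspace of the ambient space, so smoothness of \<open>W\<close> is
  expressed by smoothness in an ambient neighbourhood; only the values at admissible inputs
  are constrained.\<close>

definition LS_implicit_function ::
  "(real ^ 'n \<Rightarrow> real \<Rightarrow> real) \<Rightarrow> 'n set \<Rightarrow> real ^ 'n \<Rightarrow> real \<Rightarrow>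
    (real \<times> (real ^ 'n) \<times> real \<Rightarrow> real ^ 'n::finite) \<Rightarrow> bool" where
  "LS_implicit_function K B v k0 W \<longleftrightarrow>
     W (0, 0, k0) = 0 \<and>
     (\<exists>U. open U \<and> (0, 0, k0) \<in> U \<and> smooth_on U W \<and>
        (\<forall>x u k. (x, u, k) \<in> U \<and> u \<in> boundary_inputs B \<longrightarrow>
           W (x, u, k) \<in> linearization_image K k0 \<and>
           orthogonal_projection (linearization_image K k0)
             (network_F K (x *\<^sub>R v + W (x, u, k)) u k) = 0))"

definition LS_reduced ::
  "(real ^ 'n \<Rightarrow> real \<Rightarrow> real) \<Rightarrow> real ^ 'n \<Rightarrow> (real \<times> (real ^ 'n) \<times> real \<Rightarrow> real ^ 'n) \<Rightarrow>
    real \<Rightarrow> real ^ 'n::finite \<Rightarrow> real \<Rightarrow> real" where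
  "LS_reduced K v W x u k = v \<bullet> network_F K (x *\<^sub>R v + W (x, u, k)) u k"

definition bifurcation_germ ::
  "(real ^ 'n \<Rightarrow> real \<Rightarrow> real) \<Rightarrow> real ^ 'n \<Rightarrow> real \<Rightarrow>
    (real \<times> (real ^ 'n) \<times> real \<Rightarrow> real ^ 'n::finite) \<Rightarrow> real \<times> real \<Rightarrow> real" where
  "bifurcation_germ K v k0 W = (\<lambda>(x, \<mu>). LS_reduced K v W x 0 (k0 + \<mu>))"

end

theory Submission
  imports Defs
begin

text \<open>Let \<open>e\<close> be the incidence vector of the negative edge and \<open>t = e \<bullet> z\<close> its voltage. The positive
  Laplacian \<open>M\<close> is invertible on the complement of the all-ones vector, and \<open>M v = e\<close>. The projected
  equations at zero input say that \<open>M z - k g(t) e\<close> is a multiple \<open>c v\<close>, that is,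
  \<open>z = k g(t) v + c w\<close> with \<open>M w = v\<close>. Pairing with \<open>e\<close> and with \<open>v\<close> gives the exact formulas
  \<open>f = t - k r g(t)\<close> and \<open>x = k g(t) + \<alpha> (t - k r g(t))\<close> for a constant \<open>\<alpha>\<close>; the latter has
  derivative \<open>1/r > 0\<close> in \<open>t\<close> at the bifurcation point, so \<open>t\<close> may replace \<open>x\<close> as the state variable.
  The germ therefore becomes \<open>t - (1 + r \<mu>) g(t)\<close>, and Hadamard's lemma, applied to
  \<open>g(t) = t + t\<^sup>2 e(t)\<close>, yields explicit changes of coordinates to the transcritical and
  pitchfork normal forms. In the remaining case the germs \<open>1\<close>, \<open>t\<^sup>2\<close>, \<open>t\<^sup>3\<close> are linearly
  independent modulo the tangent space.\<close>

section \<open>Calculus of smooth maps\<close>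

text \<open>The nonlinearity enters only through one scalar, the voltage, and one fixed direction.
  This is why the reduction can be solved in closed form and \<open>W\<close> never has to be
  expanded. The same formulas with an input added, read backwards, construct \<open>W\<close>: an
  implicit function problem in many variables shrinks to inverting one increasing function of one
  variable that depends on a parameter. Germ equivalence asks for explicit \<open>S\<close>,
  \<open>X\<close> and \<open>\<Lambda>\<close>, so these are exhibited instead of applying a
  recognition criterion; the voltage is a smooth function of \<open>x\<close> and
  \<open>\<mu>\<close> and is used inside \<open>X\<close>. The germs 1, t^2, t^3 come from
  comparing orders at \<open>\<mu> = 0\<close>: there \<open>h\<close> has order at least 4,
  \<open>ddx h\<close> has order at least 3, and \<open>ddmu h\<close> begins with
  \<open>- r * t\<close>. Hence 1 and t^2 are out of reach, and t^3 could come only from terms whose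
  coefficient at the origin is shown to vanish by looking at the trivial branch.\<close>

lemma k_smooth_on_subset: "k_smooth_on n S f \<Longrightarrow> T \<subseteq> S \<Longrightarrow> k_smooth_on n T f"
  by (induction n arbitrary: f) (auto intro: continuous_on_subset)

lemma frechet_derivative_eq: "(f has_derivative f') (at x) \<Longrightarrow> frechet_derivative f (at x) = f'"
  by (rule frechet_derivative_at[symmetric])

lemma k_smooth_on_cong:
  assumes "open S" "\<And>x. x \<in> S \<Longrightarrow> f x = g x" "k_smooth_on n S f"
  shows "k_smooth_on n S g"
  using assms(2,3)
proof (induction n arbitrary: f g)
  case 0
  then show ?case
    by (metis continuous_on_cong k_smooth_on.simps(1))
next
  case (Suc n)
  have der: "(g has_derivative frechet_derivative f (at x)) (at x)" if "x \<in> S" for x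
  proof (rule has_derivative_transform_within_open[OF _ \<open>open S\<close> that])
    show "(f has_derivative frechet_derivative f (at x)) (at x)"
      using Suc.prems(2) that frechet_derivative_works by auto
  qed (use Suc.prems in auto)
  have "k_smooth_on n S (\<lambda>x. frechet_derivative g (at x) d)" for d
  proof (rule Suc.IH)
    show "k_smooth_on n S (\<lambda>x. frechet_derivative f (at x) d)"
      using Suc.prems by auto
  qed (simp add: frechet_derivative_eq[OF der])
  then show ?case
    using der by (auto simp: differentiable_def)
qed

text \<open>Turns an explicit derivative formula into smoothness, so that each closure property
  becomes an induction on the order. The formula \<open>f'\<close> is tied to
  \<open>frechet_derivative\<close> on \<open>S\<close> only, which is why
  \<open>k_smooth_on_cong\<close> and openness are involved.\<close>

lemma k_smooth_on_SucI:
  assumes "open S" "\<And>x. x \<in> S \<Longrightarrow> (f has_derivative f' x) (at x)"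
    and "\<And>d. k_smooth_on n S (\<lambda>x. f' x d)"
  shows "k_smooth_on (Suc n) S f"
proof -
  have "k_smooth_on n S (\<lambda>x. frechet_derivative f (at x) d)" for d
    by (rule k_smooth_on_cong[OF assms(1) _ assms(3)[of d]])
      (simp add: frechet_derivative_eq[OF assms(2)])
  then show ?thesis
    using assms(2) by (auto simp: differentiable_def)
qed

lemma k_smooth_on_SucE:
  assumes "k_smooth_on (Suc n) S f" "x \<in> S"
  shows "(f has_derivative frechet_derivative f (at x)) (at x)"
  using assms frechet_derivative_works by auto

lemma k_smooth_on_Suc_imp: "k_smooth_on (Suc n) S f \<Longrightarrow> k_smooth_on n S f"
proof (induction n arbitrary: f)
  case 0
  then show ?case
    by (auto intro!: continuous_at_imp_continuous_on differentiable_imp_continuous_within)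
next
  case (Suc n)
  then show ?case
    by (metis k_smooth_on.simps(2))
qed

lemma k_smooth_on_const: "k_smooth_on n S (\<lambda>x. c)"
  by (induction n arbitrary: c) auto

lemma k_smooth_on_linear_compose:
  assumes "open S" "bounded_linear L" "k_smooth_on n S f"
  shows "k_smooth_on n S (\<lambda>x. L (f x))"
  using assms(3)
proof (induction n arbitrary: f)
  case 0
  then show ?case
    by (simp add: assms(2) bounded_linear.continuous_on)
next
  case (Suc n)
  show ?case
  proof (rule k_smooth_on_SucI[OF assms(1)])
    show "((\<lambda>x. L (f x)) has_derivative (\<lambda>d. L (frechet_derivative f (at x) d))) (at x)"
      if "x \<in> S" for x
      by (rule bounded_linear.has_derivative[OF assms(2) k_smooth_on_SucE[OF Suc.prems that]])
    show "k_smooth_on n S (\<lambda>x. L (frechet_derivative f (at x) d))" for d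
      using Suc by auto
  qed
qed

lemma k_smooth_on_bounded_linear:
  assumes "open S" "bounded_linear L"
  shows "k_smooth_on n S L"
proof (induction n)
  case 0
  then show ?case
    by (simp add: assms(2) linear_continuous_on)
next
  case (Suc n)
  show ?case
    by (rule k_smooth_on_SucI[OF assms(1), of _ "\<lambda>x. L"])
      (auto intro: k_smooth_on_const bounded_linear_imp_has_derivative assms)
qed

lemma k_smooth_on_add:
  assumes "open S" "k_smooth_on n S f" "k_smooth_on n S g"
  shows "k_smooth_on n S (\<lambda>x. f x + g x)"
  using assms(2,3)
proof (induction n arbitrary: f g)
  case 0
  then show ?case
    by (simp add: continuous_on_add)
next
  case (Suc n)
  show ?case
  proof (rule k_smooth_on_SucI[OF assms(1)])
    show "((\<lambda>x. f x + g x) has_derivative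
        (\<lambda>d. frechet_derivative f (at x) d + frechet_derivative g (at x) d)) (at x)"
      if "x \<in> S" for x
      using Suc.prems that by (auto intro!: has_derivative_add k_smooth_on_SucE)
    show "k_smooth_on n S (\<lambda>x. frechet_derivative f (at x) d + frechet_derivative g (at x) d)" for d
      using Suc by auto
  qed
qed

lemma k_smooth_on_sum:
  assumes "open S" "\<And>i. i \<in> I \<Longrightarrow> k_smooth_on n S (f i)"
  shows "k_smooth_on n S (\<lambda>x. \<Sum>i\<in>I. f i x)"
  using assms(2)
  by (induction I rule: infinite_finite_induct)
    (auto intro: k_smooth_on_const k_smooth_on_add assms(1))

lemma k_smooth_on_scaleR:
  fixes f :: "'a::real_normed_vector \<Rightarrow> real"
  assumes "open S" "k_smooth_on n S f" "k_smooth_on n S g"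
  shows "k_smooth_on n S (\<lambda>x. f x *\<^sub>R g x)"
  using assms(2,3)
proof (induction n arbitrary: f g)
  case 0
  then show ?case
    by (simp add: continuous_on_scaleR)
next
  case (Suc n)
  show ?case
  proof (rule k_smooth_on_SucI[OF assms(1)])
    show "((\<lambda>x. f x *\<^sub>R g x) has_derivative
        (\<lambda>d. f x *\<^sub>R frechet_derivative g (at x) d + frechet_derivative f (at x) d *\<^sub>R g x)) (at x)"
      if "x \<in> S" for x
      using Suc.prems that by (auto intro!: has_derivative_scaleR k_smooth_on_SucE)
    show "k_smooth_on n S
        (\<lambda>x. f x *\<^sub>R frechet_derivative g (at x) d + frechet_derivative f (at x) d *\<^sub>R g x)" for d
      using Suc.prems k_smooth_on_Suc_imp[OF Suc.prems(1)] k_smooth_on_Suc_imp[OF Suc.prems(2)]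
      by (intro k_smooth_on_add assms(1) Suc.IH) simp_all
  qed
qed

text \<open>Derivatives are controlled in fixed directions only, but in the chain rule the direction
  \<open>frechet_derivative f (at x) d\<close> moves with \<open>x\<close>. Expanding it in a basis
  of the middle space leaves finitely many fixed directions; hence the sort
  \<open>euclidean_space\<close>.\<close>

lemma k_smooth_on_compose:
  fixes f :: "'a::real_normed_vector \<Rightarrow> 'b::euclidean_space"
  assumes "open S" "open T" "k_smooth_on n S f" "k_smooth_on n T g" "f ` S \<subseteq> T"
  shows "k_smooth_on n S (\<lambda>x. g (f x))"
  using assms(3,4)
proof (induction n arbitrary: g)
  case 0
  then show ?case
    using continuous_on_compose2[of T g S f] assms(5) by simp
next
  case (Suc n)
  have f: "k_smooth_on n S f" "\<And>d. k_smooth_on n S (\<lambda>x. frechet_derivative f (at x) d)"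
    using Suc.prems(1) k_smooth_on_Suc_imp by auto
  show ?case
  proof (rule k_smooth_on_SucI[OF assms(1)])
    show "((\<lambda>x. g (f x)) has_derivative
        (\<lambda>d. \<Sum>b\<in>Basis. (frechet_derivative f (at x) d \<bullet> b) *\<^sub>R frechet_derivative g (at (f x)) b)) (at x)"
      if "x \<in> S" for x
    proof -
      have dg: "(g has_derivative frechet_derivative g (at (f x))) (at (f x))"
        using Suc.prems(2) assms(5) that by (intro k_smooth_on_SucE) auto
      have lin: "linear (frechet_derivative g (at (f x)))"
        using dg has_derivative_linear by blast
      have rep: "frechet_derivative g (at (f x)) y =
          (\<Sum>b\<in>Basis. (y \<bullet> b) *\<^sub>R frechet_derivative g (at (f x)) b)" for y
      proof -
        have "frechet_derivative g (at (f x)) y =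
            frechet_derivative g (at (f x)) (\<Sum>b\<in>Basis. (y \<bullet> b) *\<^sub>R b)"
          by (simp add: euclidean_representation)
        then show ?thesis
          by (simp add: linear_sum[OF lin] linear_cmul[OF lin])
      qed
      show ?thesis
        by (intro has_derivative_eq_rhs[OF
              has_derivative_compose[OF k_smooth_on_SucE[OF Suc.prems(1) that] dg]] ext rep)
    qed
    show "k_smooth_on n S (\<lambda>x. \<Sum>b\<in>Basis.
        (frechet_derivative f (at x) d \<bullet> b) *\<^sub>R frechet_derivative g (at (f x)) b)" for d
    proof (intro k_smooth_on_sum k_smooth_on_scaleR assms(1))
      show "k_smooth_on n S (\<lambda>x. frechet_derivative f (at x) d \<bullet> b)" for b
        by (rule k_smooth_on_linear_compose[OF assms(1) bounded_linear_inner_left f(2)])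
      show "k_smooth_on n S (\<lambda>x. frechet_derivative g (at (f x)) b)" for b
        using Suc.prems(2) by (intro Suc.IH[OF f(1)]) auto
    qed
  qed
qed

section \<open>Closure properties of maps that are smooth to every order\<close>

lemma smooth_on_subset: "smooth_on S f \<Longrightarrow> T \<subseteq> S \<Longrightarrow> smooth_on T f"
  by (auto simp: smooth_on_def intro: k_smooth_on_subset)

lemma smooth_on_cong:
  "open S \<Longrightarrow> smooth_on S f \<Longrightarrow> (\<And>x. x \<in> S \<Longrightarrow> f x = g x) \<Longrightarrow> smooth_on S g"
  by (auto simp: smooth_on_def intro: k_smooth_on_cong)

lemma smooth_on_imp_continuous_on: "smooth_on S f \<Longrightarrow> continuous_on S f"
  unfolding smooth_on_def by (metis k_smooth_on.simps(1))

lemma smooth_on_has_derivative: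
  "smooth_on S f \<Longrightarrow> x \<in> S \<Longrightarrow> (f has_derivative frechet_derivative f (at x)) (at x)"
  unfolding smooth_on_def using k_smooth_on_SucE by blast

lemma smooth_on_frechet_derivative:
  "smooth_on S f \<Longrightarrow> smooth_on S (\<lambda>x. frechet_derivative f (at x) d)"
  unfolding smooth_on_def by (metis k_smooth_on.simps(2))

lemma smooth_on_const: "smooth_on S (\<lambda>x. c)"
  by (simp add: smooth_on_def k_smooth_on_const)

lemma smooth_on_bounded_linear: "open S \<Longrightarrow> bounded_linear L \<Longrightarrow> smooth_on S L"
  by (simp add: smooth_on_def k_smooth_on_bounded_linear)

lemma smooth_on_linear_compose:
  "open S \<Longrightarrow> bounded_linear L \<Longrightarrow> smooth_on S f \<Longrightarrow> smooth_on S (\<lambda>x. L (f x))"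
  by (simp add: smooth_on_def k_smooth_on_linear_compose)

lemma smooth_on_add:
  "open S \<Longrightarrow> smooth_on S f \<Longrightarrow> smooth_on S g \<Longrightarrow> smooth_on S (\<lambda>x. f x + g x)"
  by (simp add: smooth_on_def k_smooth_on_add)

lemma smooth_on_minus: "open S \<Longrightarrow> smooth_on S f \<Longrightarrow> smooth_on S (\<lambda>x. - f x)"
  by (rule smooth_on_linear_compose[OF _ bounded_linear_minus[OF bounded_linear_ident]])

lemma smooth_on_diff:
  "open S \<Longrightarrow> smooth_on S f \<Longrightarrow> smooth_on S g \<Longrightarrow> smooth_on S (\<lambda>x. f x - g x)"
  using smooth_on_add[of S f "\<lambda>x. - g x"] smooth_on_minus by auto

lemma smooth_on_scaleR:
  fixes f :: "'a::real_normed_vector \<Rightarrow> real"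
  shows "open S \<Longrightarrow> smooth_on S f \<Longrightarrow> smooth_on S g \<Longrightarrow> smooth_on S (\<lambda>x. f x *\<^sub>R g x)"
  by (simp add: smooth_on_def k_smooth_on_scaleR)

lemma smooth_on_mult:
  fixes f g :: "'a::real_normed_vector \<Rightarrow> real"
  shows "open S \<Longrightarrow> smooth_on S f \<Longrightarrow> smooth_on S g \<Longrightarrow> smooth_on S (\<lambda>x. f x * g x)"
  using smooth_on_scaleR[of S f g] by simp

lemma smooth_on_compose:
  fixes f :: "'a::real_normed_vector \<Rightarrow> 'b::euclidean_space"
  shows "open S \<Longrightarrow> open T \<Longrightarrow> smooth_on S f \<Longrightarrow> smooth_on T g \<Longrightarrow> f ` S \<subseteq> T \<Longrightarrow>
    smooth_on S (\<lambda>x. g (f x))"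
  unfolding smooth_on_def by (blast intro: k_smooth_on_compose)

lemma smooth_on_Pair:
  assumes "open S" "smooth_on S f" "smooth_on S g"
  shows "smooth_on S (\<lambda>x. (f x, g x))"
proof -
  have "bounded_linear (\<lambda>y. (y, 0))" "bounded_linear (\<lambda>y. (0, y))"
    by (auto intro!: bounded_linear_intros bounded_linear_Pair)
  then have "smooth_on S (\<lambda>x. (f x, 0) + (0, g x))"
    using assms by (intro smooth_on_add) (auto intro: smooth_on_linear_compose)
  then show ?thesis
    by simp
qed

text \<open>The derivative of the reciprocal is a product of the reciprocal itself and derivatives
  of \<open>f\<close>. With \<open>f\<close> smooth and fixed, order \<open>n\<close> of the
  reciprocal therefore yields order \<open>n + 1\<close>.\<close>

lemma smooth_on_inverse:
  fixes f :: "'a::real_normed_vector \<Rightarrow> real"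
  assumes "open S" "smooth_on S f" "\<And>x. x \<in> S \<Longrightarrow> f x \<noteq> 0"
  shows "smooth_on S (\<lambda>x. inverse (f x))"
  unfolding smooth_on_def
proof
  fix n
  show "k_smooth_on n S (\<lambda>x. inverse (f x))"
  proof (induction n)
    case 0
    then show ?case
      using assms continuous_on_inverse[OF smooth_on_imp_continuous_on[OF assms(2)]] by simp
  next
    case (Suc n)
    show ?case
    proof (rule k_smooth_on_SucI[OF assms(1)])
      show "((\<lambda>x. inverse (f x)) has_derivative
          (\<lambda>d. - (inverse (f x) * frechet_derivative f (at x) d * inverse (f x)))) (at x)"
        if "x \<in> S" for x
        by (rule Deriv.has_derivative_inverse[OF assms(3)[OF that] smooth_on_has_derivative[OF assms(2) that]])
      have "k_smooth_on n S (\<lambda>x. - ((inverse (f x) *\<^sub>R frechet_derivative f (at x) d) *\<^sub>R inverse (f x)))" for d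
        using smooth_on_frechet_derivative[OF assms(2), of d] Suc
        by (intro k_smooth_on_linear_compose[OF assms(1) bounded_linear_minus[OF bounded_linear_ident]]
            k_smooth_on_scaleR assms(1)) (auto simp: smooth_on_def)
      then show "k_smooth_on n S (\<lambda>x. - (inverse (f x) * frechet_derivative f (at x) d * inverse (f x)))" for d
        by simp
    qed
  qed
qed

lemma smooth_on_divide:
  fixes f g :: "'a::real_normed_vector \<Rightarrow> real"
  shows "open S \<Longrightarrow> smooth_on S f \<Longrightarrow> smooth_on S g \<Longrightarrow> (\<And>x. x \<in> S \<Longrightarrow> g x \<noteq> 0) \<Longrightarrow>
    smooth_on S (\<lambda>x. f x / g x)"
  unfolding divide_inverse by (intro smooth_on_mult smooth_on_inverse)

text \<open>The same bootstrap: the factor \<open>1 / (2 * sqrt f)\<close> of the derivative is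
  rewritten as \<open>sqrt f * inverse (2 * f)\<close>, where only the square root is not yet known
  to be smooth.\<close>

lemma smooth_on_sqrt:
  fixes f :: "'a::real_normed_vector \<Rightarrow> real"
  assumes "open S" "smooth_on S f" "\<And>x. x \<in> S \<Longrightarrow> f x > 0"
  shows "smooth_on S (\<lambda>x. sqrt (f x))"
  unfolding smooth_on_def
proof
  fix n
  show "k_smooth_on n S (\<lambda>x. sqrt (f x))"
  proof (induction n)
    case 0
    then show ?case
      using continuous_on_real_sqrt[OF smooth_on_imp_continuous_on[OF assms(2)]] by simp
  next
    case (Suc n)
    show ?case
    proof (rule k_smooth_on_SucI[OF assms(1)])
      show "((\<lambda>x. sqrt (f x)) has_derivative
          (\<lambda>d. (sqrt (f x) * inverse (2 * f x)) * frechet_derivative f (at x) d)) (at x)"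
        if "x \<in> S" for x
      proof -
        have "sqrt (f x) * inverse (2 * f x) = inverse (sqrt (f x)) / 2"
          using assms(3)[OF that] real_div_sqrt[of "f x"] by (simp add: field_simps)
        then show ?thesis
          using DERIV_compose_FDERIV[OF DERIV_real_sqrt[OF assms(3)[OF that]]
              smooth_on_has_derivative[OF assms(2) that]]
          by (simp add: mult.commute)
      qed
      have "smooth_on S (\<lambda>x. inverse (2 * f x))"
        using assms by (intro smooth_on_inverse smooth_on_mult smooth_on_const) (auto dest: assms(3))
      then have "k_smooth_on n S (\<lambda>x. (sqrt (f x) *\<^sub>R inverse (2 * f x)) *\<^sub>R frechet_derivative f (at x) d)" for d
        using smooth_on_frechet_derivative[OF assms(2), of d] Suc
        by (intro k_smooth_on_scaleR assms(1)) (auto simp: smooth_on_def)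
      then show "k_smooth_on n S (\<lambda>x. (sqrt (f x) * inverse (2 * f x)) * frechet_derivative f (at x) d)" for d
        by simp
    qed
  qed
qed

section \<open>Smooth germs and Taylor quotients\<close>

lemma smooth_on_has_real_derivative:
  fixes f :: "real \<Rightarrow> real"
  assumes "smooth_on S f" "x \<in> S"
  shows "(f has_real_derivative deriv f x) (at x)"
proof -
  have "f differentiable at x"
    using smooth_on_has_derivative[OF assms] by (auto simp: differentiable_def)
  then show ?thesis
    using DERIV_deriv_iff_real_differentiable by blast
qed

lemma smooth_on_deriv:
  fixes f :: "real \<Rightarrow> real"
  assumes "open S" "smooth_on S f"
  shows "smooth_on S (deriv f)"
proof (rule smooth_on_cong[OF assms(1) smooth_on_frechet_derivative[OF assms(2), of 1]])
  fix x assume "x \<in> S"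
  then have "(f has_derivative (*) (deriv f x)) (at x)"
    using smooth_on_has_real_derivative[OF assms(2)] by (simp add: has_field_derivative_def)
  then show "frechet_derivative f (at x) 1 = deriv f x"
    by (simp add: frechet_derivative_eq)
qed

section \<open>Division of a smooth function by its variable\<close>

lemma k_smooth_on_Suc_realI:
  fixes f f' :: "real \<Rightarrow> real"
  assumes "open S" "\<And>x. x \<in> S \<Longrightarrow> (f has_real_derivative f' x) (at x)" "k_smooth_on n S f'"
  shows "k_smooth_on (Suc n) S f"
proof (rule k_smooth_on_SucI[OF assms(1)])
  show "(f has_derivative (\<lambda>d. d * f' x)) (at x)" if "x \<in> S" for x
    using assms(2)[OF that] by (simp add: has_field_derivative_def mult.commute[of _ "f' x"])
  show "k_smooth_on n S (\<lambda>x. d * f' x)" for d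
    by (rule k_smooth_on_linear_compose[OF assms(1) bounded_linear_mult_right assms(3)])
qed

text \<open>The Hadamard quotient of \<open>f\<close> is the mean of \<open>deriv f\<close> with
  \<open>j = 0\<close>. The weight \<open>t ^ j\<close> closes the family under differentiation:
  differentiating under the integral replaces \<open>f\<close> by \<open>deriv f\<close> and
  \<open>j\<close> by \<open>Suc j\<close>.\<close>

definition weighted_mean :: "nat \<Rightarrow> (real \<Rightarrow> real) \<Rightarrow> real \<Rightarrow> real" where
  "weighted_mean j f x = integral {0..1} (\<lambda>t. t ^ j * f (t * x))"

lemma weighted_mean_has_derivative:
  assumes "smooth_on UNIV f"
  shows "(weighted_mean j f has_real_derivative weighted_mean (Suc j) (deriv f) x) (at x)"
proof -
  have cont: "continuous_on A f" "continuous_on A (deriv f)" for A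
    using assms smooth_on_deriv[OF open_UNIV assms]
    by (meson continuous_on_subset smooth_on_imp_continuous_on subset_UNIV)+
  have "((\<lambda>x. integral (cbox 0 1) (\<lambda>t. t ^ j * f (t * x))) has_real_derivative
      integral (cbox 0 1) (\<lambda>t. t ^ Suc j * deriv f (t * x))) (at x within UNIV)"
  proof (rule leibniz_rule_field_derivative)
    show "((\<lambda>x. t ^ j * f (t * x)) has_real_derivative t ^ Suc j * deriv f (t * x)) (at x within UNIV)"
      for x t
    proof -
      have "((\<lambda>x. f (t * x)) has_real_derivative deriv f (t * x) * t) (at x)"
        by (rule DERIV_chain2[OF smooth_on_has_real_derivative[OF assms]])
          (auto intro!: derivative_eq_intros)
      then show ?thesis
        by (auto intro!: derivative_eq_intros)
    qed
    show "(\<lambda>t. t ^ j * f (t * x)) integrable_on cbox 0 1" for x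
      by (intro integrable_continuous continuous_intros continuous_on_compose2[OF cont(1)[of UNIV]]) auto
    show "continuous_on (UNIV \<times> cbox 0 1) (\<lambda>(x, t). t ^ Suc j * deriv f (t * x))"
      unfolding split_def
      by (intro continuous_intros continuous_on_compose2[OF cont(2)[of UNIV]]) auto
  qed auto
  then show ?thesis
    by (simp add: weighted_mean_def[abs_def])
qed

lemma smooth_on_weighted_mean:
  assumes "smooth_on UNIV f"
  shows "smooth_on UNIV (weighted_mean j f)"
  unfolding smooth_on_def
proof
  fix n
  show "k_smooth_on n UNIV (weighted_mean j f)"
    using assms
  proof (induction n arbitrary: j f)
    case 0
    show ?case
      using DERIV_isCont[OF weighted_mean_has_derivative[OF 0]]
      by (simp add: continuous_at_imp_continuous_on)
  next
    case (Suc n)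
    show ?case
      by (rule k_smooth_on_Suc_realI[OF open_UNIV weighted_mean_has_derivative[OF Suc.prems]])
        (intro Suc.IH smooth_on_deriv open_UNIV Suc.prems)
  qed
qed

lemma weighted_mean_at_0: "weighted_mean j f 0 = f 0 / (j + 1)"
proof -
  let ?c = "f 0 / (j + 1)"
  have "((\<lambda>t. t ^ Suc j * ?c) has_real_derivative t ^ j * f 0) (at t within {0..1})" for t :: real
    using DERIV_cmult_right[OF DERIV_pow[of "Suc j" t "{0..1}"], of ?c]
    by (simp add: mult.commute nonzero_eq_divide_eq add_nonneg_eq_0_iff del: power_Suc)
  then have "((\<lambda>t. t ^ j * f 0) has_integral (1 ^ Suc j * ?c - 0 ^ Suc j * ?c)) {0..1}"
    by (intro fundamental_theorem_of_calculus)
      (auto simp: has_real_derivative_iff_has_vector_derivative[symmetric] simp del: power_Suc)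
  then show ?thesis
    by (auto simp: weighted_mean_def dest: integral_unique)
qed

text \<open>Integrating the derivative of \<open>f (t * x)\<close> in \<open>t\<close> over the unit
  interval produces the factor \<open>x\<close>. The values at 0, with denominators 2 and 3 from
  integrating \<open>t ^ j\<close>, are recorded because the division is iterated and each round
  needs the next Taylor coefficient.\<close>

lemma hadamard_quotient:
  fixes f :: "real \<Rightarrow> real"
  assumes "smooth_on UNIV f" "f 0 = 0"
  obtains q where "smooth_on UNIV q" "\<And>x. f x = x * q x" "q 0 = deriv f 0"
    "deriv q 0 = deriv (deriv f) 0 / 2" "deriv (deriv q) 0 = deriv (deriv (deriv f)) 0 / 3"
proof
  let ?q = "weighted_mean 0 (deriv f)"
  have sm: "smooth_on UNIV (deriv f)" "smooth_on UNIV (deriv (deriv f))"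
    using assms(1) by (auto intro: smooth_on_deriv)
  show "smooth_on UNIV ?q"
    by (rule smooth_on_weighted_mean[OF sm(1)])
  have d1: "deriv ?q = weighted_mean (Suc 0) (deriv (deriv f))"
    by (intro ext DERIV_imp_deriv weighted_mean_has_derivative sm)
  have d2: "deriv (weighted_mean (Suc 0) (deriv (deriv f))) =
      weighted_mean (Suc (Suc 0)) (deriv (deriv (deriv f)))"
    by (intro ext DERIV_imp_deriv weighted_mean_has_derivative sm)
  show "?q 0 = deriv f 0"
    unfolding weighted_mean_at_0 by simp
  show "deriv ?q 0 = deriv (deriv f) 0 / 2"
    unfolding d1 weighted_mean_at_0 by simp
  show "deriv (deriv ?q) 0 = deriv (deriv (deriv f)) 0 / 3"
    unfolding d1 d2 weighted_mean_at_0 by simp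
  fix x
  have "((\<lambda>t. x * deriv f (t * x)) has_integral (f (1 * x) - f (0 * x))) {0..1}"
  proof (rule fundamental_theorem_of_calculus)
    show "((\<lambda>t. f (t * x)) has_vector_derivative x * deriv f (t * x)) (at t within {0..1})" for t
    proof -
      have "((\<lambda>t. f (t * x)) has_real_derivative deriv f (t * x) * x) (at t)"
        by (rule DERIV_chain2[OF smooth_on_has_real_derivative[OF assms(1)]])
          (auto intro!: derivative_eq_intros)
      then show ?thesis
        by (simp add: has_real_derivative_iff_has_vector_derivative mult.commute
            has_vector_derivative_at_within)
    qed
  qed auto
  then show "f x = x * ?q x"
    using assms(2) by (auto simp: weighted_mean_def dest: integral_unique)
qed

section \<open>Algebra of smooth germs\<close>

lemma smooth_germI: "open U \<Longrightarrow> 0 \<in> U \<Longrightarrow> smooth_on U f \<Longrightarrow> smooth_germ f"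
  by (auto simp: smooth_germ_def)

lemma smooth_germ_binary:
  assumes "smooth_germ f" "smooth_germ g"
    and "\<And>U. open U \<Longrightarrow> smooth_on U f \<Longrightarrow> smooth_on U g \<Longrightarrow> smooth_on U h"
  shows "smooth_germ h"
proof -
  obtain U V where "open U" "0 \<in> U" "smooth_on U f" "open V" "0 \<in> V" "smooth_on V g"
    using assms by (auto simp: smooth_germ_def)
  then show ?thesis
    by (intro smooth_germI[of "U \<inter> V"] assms(3)) (auto intro: smooth_on_subset)
qed

lemma smooth_germ_const: "smooth_germ (\<lambda>x. c)"
  by (rule smooth_germI[OF open_UNIV]) (auto intro: smooth_on_const)

lemma smooth_germ_bounded_linear: "bounded_linear f \<Longrightarrow> smooth_germ f"
  by (rule smooth_germI[OF open_UNIV]) (auto intro: smooth_on_bounded_linear)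

lemma smooth_germ_linear_compose: "bounded_linear L \<Longrightarrow> smooth_germ f \<Longrightarrow> smooth_germ (\<lambda>x. L (f x))"
  by (rule smooth_germ_binary[of f f]) (auto intro: smooth_on_linear_compose)

lemma smooth_germ_add: "smooth_germ f \<Longrightarrow> smooth_germ g \<Longrightarrow> smooth_germ (\<lambda>x. f x + g x)"
  by (erule smooth_germ_binary, assumption) (rule smooth_on_add)

lemma smooth_germ_diff: "smooth_germ f \<Longrightarrow> smooth_germ g \<Longrightarrow> smooth_germ (\<lambda>x. f x - g x)"
  by (erule smooth_germ_binary, assumption) (rule smooth_on_diff)

lemma smooth_germ_mult:
  fixes f g :: "'a::real_normed_vector \<Rightarrow> real"
  shows "smooth_germ f \<Longrightarrow> smooth_germ g \<Longrightarrow> smooth_germ (\<lambda>x. f x * g x)"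
  by (erule smooth_germ_binary, assumption) (rule smooth_on_mult)

lemma smooth_germ_power:
  fixes f :: "'a::real_normed_vector \<Rightarrow> real"
  shows "smooth_germ f \<Longrightarrow> smooth_germ (\<lambda>x. f x ^ n)"
  by (induction n) (auto intro: smooth_germ_const smooth_germ_mult)

lemma smooth_germ_isCont:
  assumes "smooth_germ f"
  shows "isCont f 0"
  using assms smooth_on_imp_continuous_on continuous_on_eq_continuous_at
  unfolding smooth_germ_def by blast

text \<open>The outer map is given on an open set around \<open>f 0\<close>, not around the origin,
  because inner germs with nonzero value occur: denominators, radicands, and the base point of the
  reduction.\<close>

lemma smooth_germ_compose:
  fixes f :: "'a::real_normed_vector \<Rightarrow> 'b::euclidean_space"
  assumes "smooth_germ f" "open T" "smooth_on T g" "f 0 \<in> T"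
  shows "smooth_germ (\<lambda>x. g (f x))"
proof -
  obtain U where U: "open U" "0 \<in> U" "smooth_on U f"
    using assms(1) by (auto simp: smooth_germ_def)
  let ?V = "U \<inter> f -` T"
  have "open ?V"
    using continuous_open_preimage[OF smooth_on_imp_continuous_on[OF U(3)] U(1) assms(2)] .
  moreover have "0 \<in> ?V"
    using U assms(4) by auto
  moreover have "smooth_on ?V (\<lambda>x. g (f x))"
    using \<open>open ?V\<close> by (intro smooth_on_compose[OF _ assms(2) smooth_on_subset[OF U(3)] assms(3)]) auto
  ultimately show ?thesis
    by (rule smooth_germI)
qed

lemma smooth_germ_divide:
  fixes f g :: "'a::real_normed_vector \<Rightarrow> real"
  assumes "smooth_germ f" "smooth_germ g" "g 0 \<noteq> 0"
  shows "smooth_germ (\<lambda>x. f x / g x)"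
proof -
  have "smooth_on (- {0::real}) inverse"
    by (rule smooth_on_inverse) (auto intro: smooth_on_bounded_linear)
  from smooth_germ_compose[OF assms(2) _ this] show ?thesis
    unfolding divide_inverse using assms by (intro smooth_germ_mult) auto
qed

lemma smooth_germ_sqrt:
  fixes f :: "'a::real_normed_vector \<Rightarrow> real"
  assumes "smooth_germ f" "f 0 > 0"
  shows "smooth_germ (\<lambda>x. sqrt (f x))"
proof -
  have "smooth_on {0<..} sqrt"
    by (rule smooth_on_sqrt) (auto intro: smooth_on_bounded_linear)
  from smooth_germ_compose[OF assms(1) _ this] show ?thesis
    using assms by auto
qed

lemma eventually_nhds_pos:
  fixes f :: "'a::t2_space \<Rightarrow> real"
  assumes "isCont f a" "f a > 0"
  shows "\<forall>\<^sub>F x in nhds a. f x > 0"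
proof -
  have "(f \<longlongrightarrow> f a) (nhds a)"
    using assms(1) tendsto_at_iff_tendsto_nhds unfolding isCont_def by blast
  then show ?thesis
    by (rule order_tendstoD(1)) (rule assms(2))
qed

lemma smooth_germ_eventually:
  assumes "smooth_germ f"
  obtains U where "open U" "0 \<in> U" "smooth_on U f" "\<forall>\<^sub>F p in nhds 0. p \<in> U"
  using assms eventually_nhds_in_open unfolding smooth_germ_def by metis

section \<open>Partial derivatives of germs in two variables\<close>

lemma smooth_on_partial_derivatives:
  fixes f :: "real \<times> real \<Rightarrow> real"
  assumes "smooth_on U f" "(x, m) \<in> U"
  shows "((\<lambda>t. f (t, m)) has_real_derivative ddx f (x, m)) (at x)"
    and "((\<lambda>t. f (x, t)) has_real_derivative ddmu f (x, m)) (at m)"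
    and "ddx f (x, m) = frechet_derivative f (at (x, m)) (1, 0)"
    and "ddmu f (x, m) = frechet_derivative f (at (x, m)) (0, 1)"
proof -
  let ?D = "frechet_derivative f (at (x, m))"
  have D: "(f has_derivative ?D) (at (x, m))"
    by (rule smooth_on_has_derivative[OF assms])
  then have lin: "linear ?D"
    using has_derivative_linear by blast
  have "((\<lambda>t. f (t, m)) has_derivative (\<lambda>d. ?D (d, 0))) (at x)"
    by (rule has_derivative_compose[where f = "\<lambda>t. (t, m)", OF _ D]) (auto intro!: derivative_eq_intros)
  moreover have "(\<lambda>d. ?D (d, 0)) = (*) (?D (1, 0))"
  proof
    fix d
    show "?D (d, 0) = ?D (1, 0) * d"
      using linear_cmul[OF lin, of d "(1, 0)"] by (simp add: mult.commute)
  qed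
  ultimately have 1: "((\<lambda>t. f (t, m)) has_real_derivative ?D (1, 0)) (at x)"
    unfolding has_field_derivative_def by metis
  have "((\<lambda>t. f (x, t)) has_derivative (\<lambda>d. ?D (0, d))) (at m)"
    by (rule has_derivative_compose[where f = "\<lambda>t. (x, t)", OF _ D]) (auto intro!: derivative_eq_intros)
  moreover have "(\<lambda>d. ?D (0, d)) = (*) (?D (0, 1))"
  proof
    fix d
    show "?D (0, d) = ?D (0, 1) * d"
      using linear_cmul[OF lin, of d "(0, 1)"] by (simp add: mult.commute)
  qed
  ultimately have 2: "((\<lambda>t. f (x, t)) has_real_derivative ?D (0, 1)) (at m)"
    unfolding has_field_derivative_def by metis
  show "ddx f (x, m) = ?D (1, 0)" "ddmu f (x, m) = ?D (0, 1)"
    using 1 2 by (auto simp: ddx_def ddmu_def intro: DERIV_imp_deriv)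
  then show "((\<lambda>t. f (t, m)) has_real_derivative ddx f (x, m)) (at x)"
    "((\<lambda>t. f (x, t)) has_real_derivative ddmu f (x, m)) (at m)"
    using 1 2 by auto
qed

lemma smooth_germ_has_ddx:
  fixes f :: "real \<times> real \<Rightarrow> real"
  assumes "smooth_germ f"
  shows "((\<lambda>t. f (t, 0)) has_real_derivative ddx f 0) (at 0)"
  using assms smooth_on_partial_derivatives(1)[of _ f 0 0]
  by (auto simp: smooth_germ_def zero_prod_def)

lemma smooth_germ_ddx_ddmu:
  assumes "smooth_germ f"
  shows "smooth_germ (ddx f)" "smooth_germ (ddmu f)"
proof -
  obtain U where U: "open U" "0 \<in> U" "smooth_on U f"
    using assms by (auto simp: smooth_germ_def)
  have "smooth_on U (ddx f)" "smooth_on U (ddmu f)"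
    using smooth_on_cong[OF U(1) smooth_on_frechet_derivative[OF U(3), of "(1, 0)"], of "ddx f"]
      smooth_on_cong[OF U(1) smooth_on_frechet_derivative[OF U(3), of "(0, 1)"], of "ddmu f"]
      smooth_on_partial_derivatives(3,4)[OF U(3)] by auto
  then show "smooth_germ (ddx f)" "smooth_germ (ddmu f)"
    using U smooth_germI by auto
qed

section \<open>Inverting a germ in the state variable\<close>

lemma eventually_nhds_0_box:
  fixes P :: "real \<times> real \<Rightarrow> bool"
  assumes "\<forall>\<^sub>F p in nhds 0. P p"
  shows "\<exists>a>0. \<forall>x m. \<bar>x\<bar> < a \<longrightarrow> \<bar>m\<bar> < a \<longrightarrow> P (x, m)"
proof -
  obtain e where e: "e > 0" "\<And>p. dist p 0 < e \<Longrightarrow> P p"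
    using assms by (auto simp: eventually_nhds_metric)
  show ?thesis
  proof (intro exI[of _ "e / 2"] conjI allI impI)
    fix x m :: real
    assume "\<bar>x\<bar> < e / 2" "\<bar>m\<bar> < e / 2"
    then have "norm (x, m) < e"
      using norm_Pair_le[of x m] by simp
    then show "P (x, m)"
      by (intro e(2)) (simp add: zero_prod_def dist_norm)
  qed (use e in simp)
qed

text \<open>An inverse function theorem with a parameter, applied to the fibre preserving map
  \<open>\<Phi>\<close>. Monotonicity on the fibres gives injectivity, invariance of domain gives an
  open image, and smoothness of the inverse follows by bootstrapping. \<open>P\<close> is carried
  along so that a single box serves all local conditions.\<close>

lemma local_fibrewise_inverse:
  fixes X :: "real \<times> real \<Rightarrow> real"
  assumes "smooth_germ X" "ddx X 0 > 0" "\<forall>\<^sub>F p in nhds 0. P p"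
  obtains a V Y where "a > 0" "open V" "smooth_on V Y" "continuous_on V Y"
    "\<forall>x m. \<bar>x\<bar> < a \<longrightarrow> \<bar>m\<bar> < a \<longrightarrow> (X (x, m), m) \<in> V \<and> Y (X (x, m), m) = x \<and> P (x, m)"
    "\<forall>y m. (y, m) \<in> V \<longrightarrow> \<bar>Y (y, m)\<bar> < a \<and> \<bar>m\<bar> < a \<and> X (Y (y, m), m) = y"
    "\<forall>x x' m. \<bar>x\<bar> < a \<longrightarrow> \<bar>x'\<bar> < a \<longrightarrow> \<bar>m\<bar> < a \<longrightarrow> x < x' \<longrightarrow> X (x, m) < X (x', m)"
proof -
  obtain U where U: "open U" "0 \<in> U" "smooth_on U X" "\<forall>\<^sub>F p in nhds 0. p \<in> U"
    using smooth_germ_eventually[OF assms(1)] by blast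
  have "\<forall>\<^sub>F p in nhds 0. ddx X p > 0"
    using assms(1,2) by (intro eventually_nhds_pos smooth_germ_isCont smooth_germ_ddx_ddmu)
  with U(4) assms(3) have "\<forall>\<^sub>F p in nhds 0. p \<in> U \<and> ddx X p > 0 \<and> P p"
    by eventually_elim simp
  then obtain a where a: "a > 0"
    "\<And>x m. \<bar>x\<bar> < a \<Longrightarrow> \<bar>m\<bar> < a \<Longrightarrow> (x, m) \<in> U \<and> ddx X (x, m) > 0 \<and> P (x, m)"
    by (blast dest: eventually_nhds_0_box)
  \<comment> \<open>A square: its slices at fixed \<open>m\<close> are intervals, so the sign of
    \<open>ddx X\<close> gives monotonicity on them.\<close>
  define Q where "Q = {-a<..<a} \<times> {-a<..<a}"
  have Q: "open Q" "Q \<subseteq> U"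
    using a by (auto simp: Q_def open_Times)
  have smX: "smooth_on Q X"
    by (rule smooth_on_subset[OF U(3) Q(2)])
  define \<Phi> where "\<Phi> = (\<lambda>p. (X p, snd p))"
  have mono: "X (x, m) < X (x', m)" if "\<bar>x\<bar> < a" "\<bar>x'\<bar> < a" "\<bar>m\<bar> < a" "x < x'" for x x' m
  proof (rule DERIV_pos_imp_increasing[OF that(4)])
    fix t assume "x \<le> t" "t \<le> x'"
    with that have "\<bar>t\<bar> < a" by auto
    then show "\<exists>y. ((\<lambda>t. X (t, m)) has_real_derivative y) (at t) \<and> 0 < y"
      using a(2)[of t m] smooth_on_partial_derivatives(1)[OF U(3)] that(3) by blast
  qed
  have inj: "inj_on \<Phi> Q"
  proof (rule inj_onI)
    fix p q assume pq: "p \<in> Q" "q \<in> Q" "\<Phi> p = \<Phi> q"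
    obtain x m x' m' where "p = (x, m)" "q = (x', m')"
      by (metis surj_pair)
    then show "p = q"
      using pq mono[of x x' m] mono[of x' x m] by (fastforce simp: Q_def \<Phi>_def)
  qed
  have cont: "continuous_on Q \<Phi>"
    unfolding \<Phi>_def by (intro continuous_intros smooth_on_imp_continuous_on smX)
  define V where "V = \<Phi> ` Q"
  define \<Psi> where "\<Psi> = inv_into Q \<Phi>"
  have V: "open V"
    unfolding V_def by (rule invariance_of_domain_gen[OF Q(1) cont inj]) simp
  have inv: "\<Psi> (\<Phi> p) = p" if "p \<in> Q" for p
    using inj that by (simp add: \<Psi>_def)
  have cont_\<Psi>: "continuous_on V \<Psi>"
    unfolding V_def by (rule continuous_on_inverse_open[OF Q(1) cont _ inv]) auto
  have \<Psi>: "\<Psi> q \<in> Q" "\<Phi> (\<Psi> q) = q" if "q \<in> V" for q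
    using that unfolding V_def \<Psi>_def by (auto intro: inv_into_into f_inv_into_f)
  define Y where "Y = (\<lambda>q. fst (\<Psi> q))"
  have \<Psi>_eq: "\<Psi> q = (Y q, snd q)" if "q \<in> V" for q
    using \<Psi>(2)[OF that] by (auto simp: Y_def \<Phi>_def prod_eq_iff)
  have cont_Y: "continuous_on V Y"
    unfolding Y_def by (intro continuous_intros cont_\<Psi>)
  define X1 where "X1 = (\<lambda>p. frechet_derivative X (at p) (1, 0))"
  define X2 where "X2 = (\<lambda>p. frechet_derivative X (at p) (0, 1))"
  have X1_pos: "X1 p > 0" if "p \<in> Q" for p
    using a(2)[of "fst p" "snd p"] that smooth_on_partial_derivatives(3)[OF U(3), of "fst p" "snd p"]
    by (auto simp: Q_def X1_def)
  have sm12: "smooth_on Q X1" "smooth_on Q X2"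
    using smooth_on_frechet_derivative[OF smX] by (auto simp: X1_def X2_def)
  have der_X: "(X has_derivative (\<lambda>d. X1 p * fst d + X2 p * snd d)) (at p)" if "p \<in> Q" for p
  proof -
    let ?D = "frechet_derivative X (at p)"
    have D: "(X has_derivative ?D) (at p)"
      by (rule smooth_on_has_derivative[OF smX that])
    then have lin: "linear ?D"
      using has_derivative_linear by blast
    have "?D d = X1 p * fst d + X2 p * snd d" for d
    proof -
      have "?D d = ?D (fst d *\<^sub>R (1, 0) + snd d *\<^sub>R (0, 1))"
        by simp
      then show ?thesis
        by (simp only: linear_add[OF lin] linear_cmul[OF lin] X1_def X2_def) simp
    qed
    then show ?thesis
      using D by presburger
  qed
  \<comment> \<open>The inverse of the Jacobian of \<open>\<Phi>\<close>, which is triangular since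
    \<open>\<Phi>\<close> preserves the second coordinate.\<close>
  define G where "G = (\<lambda>p d. ((fst d - X2 p * snd d) / X1 p, snd d :: real))"
  have der_\<Psi>: "(\<Psi> has_derivative G (\<Psi> q)) (at q)" if q: "q \<in> V" for q
  proof (rule has_derivative_inverse_basic[OF _ _ _ _ V q])
    let ?p = "\<Psi> q"
    show "(\<Phi> has_derivative (\<lambda>d. (X1 ?p * fst d + X2 ?p * snd d, snd d))) (at ?p)"
      unfolding \<Phi>_def by (intro has_derivative_Pair der_X \<Psi>(1) q derivative_intros)
    show "bounded_linear (G ?p)"
      unfolding G_def
      by (intro bounded_linear_Pair bounded_linear_divide[THEN bounded_linear_compose]
          bounded_linear_sub bounded_linear_mult_right[THEN bounded_linear_compose]
          bounded_linear_fst bounded_linear_snd)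
    show "G ?p \<circ> (\<lambda>d. (X1 ?p * fst d + X2 ?p * snd d, snd d)) = id"
      using X1_pos[OF \<Psi>(1)[OF q]] by (auto simp: G_def fun_eq_iff)
    show "continuous (at q) \<Psi>"
      using cont_\<Psi> V q continuous_on_eq_continuous_at by blast
    show "\<Phi> (\<Psi> z) = z" if "z \<in> V" for z
      by (rule \<Psi>(2)[OF that])
  qed
  \<comment> \<open>The derivative of \<open>Y\<close> is a smooth function of
    \<open>\<Psi>\<close>, and \<open>\<Psi>\<close> is \<open>Y\<close> paired with a projection,
    hence as regular as \<open>Y\<close>. Each order of \<open>Y\<close> thus gives the next
    one.\<close>
  have "k_smooth_on n V Y" for n
  proof (induction n)
    case 0
    then show ?case
      using cont_Y by simp
  next
    case (Suc n)
    have "k_smooth_on n V (\<lambda>q. (0 + (Y q *\<^sub>R (1, 0)) + (0, snd q)))"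
      by (intro k_smooth_on_add k_smooth_on_scaleR k_smooth_on_const Suc V
          k_smooth_on_bounded_linear bounded_linear_Pair bounded_linear_zero bounded_linear_snd)
    then have ks\<Psi>: "k_smooth_on n V \<Psi>"
      by (rule k_smooth_on_cong[OF V, rotated]) (simp add: \<Psi>_eq)
    show ?case
    proof (rule k_smooth_on_SucI[OF V])
      show "(Y has_derivative (\<lambda>d. fst (G (\<Psi> q) d))) (at q)" if "q \<in> V" for q
        unfolding Y_def by (intro derivative_intros der_\<Psi> that)
      fix d
      have "smooth_on Q (\<lambda>p. fst (G p d))"
        unfolding G_def fst_conv
        by (intro smooth_on_divide smooth_on_diff smooth_on_mult smooth_on_const sm12 Q(1))
          (use X1_pos in force)
      then show "k_smooth_on n V (\<lambda>q. fst (G (\<Psi> q) d))"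
        by (intro k_smooth_on_compose[OF V Q(1) ks\<Psi>]) (use \<Psi>(1) in \<open>auto simp: smooth_on_def\<close>)
    qed
  qed
  then have smY: "smooth_on V Y"
    by (simp add: smooth_on_def)
  show ?thesis
  proof (rule that[OF a(1) V smY cont_Y]; intro allI impI)
    fix x m assume "\<bar>x\<bar> < a" "\<bar>m\<bar> < a"
    then have "(x, m) \<in> Q" by (auto simp: Q_def)
    then show "(X (x, m), m) \<in> V \<and> Y (X (x, m), m) = x \<and> P (x, m)"
      using inv[of "(x, m)"] a(2)[OF \<open>\<bar>x\<bar> < a\<close> \<open>\<bar>m\<bar> < a\<close>]
      by (auto simp: V_def \<Phi>_def Y_def)
  next
    fix y m assume "(y, m) \<in> V"
    then show "\<bar>Y (y, m)\<bar> < a \<and> \<bar>m\<bar> < a \<and> X (Y (y, m), m) = y"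
      using \<Psi>[of "(y, m)"] \<Psi>_eq[of "(y, m)"] by (auto simp: Q_def \<Phi>_def)
  qed (rule mono)
qed

text \<open>Both normal forms are reached with a linear \<open>\<Lambda>\<close>. The positivity
  conditions are open, so they need checking at the origin only.\<close>

lemma germ_equivalent_linear_parameterI:
  assumes "smooth_germ S" "smooth_germ X" "X 0 = 0" "S 0 > 0" "ddx X 0 > 0" "c > 0"
    and "\<forall>\<^sub>F p in nhds 0. h p = S p * q (X p, c * snd p)"
  shows "germ_equivalent h q"
proof -
  have "\<forall>\<^sub>F p in nhds 0. S p > 0" "\<forall>\<^sub>F p in nhds 0. ddx X p > 0"
    using assms by (auto intro!: eventually_nhds_pos smooth_germ_isCont smooth_germ_ddx_ddmu)
  with assms(7) have ev: "\<forall>\<^sub>F p in nhds 0. h p = S p * q (X p, c * snd p) \<and> S p > 0 \<and> ddx X p > 0"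
    by eventually_elim auto
  have "deriv (\<lambda>m. c * m) m = c" for m
    by (rule DERIV_imp_deriv) (auto intro!: derivative_eq_intros)
  then have "\<forall>\<^sub>F m in nhds 0. deriv (\<lambda>m. c * m) m > 0"
    using assms(6) by simp
  then show ?thesis
    using assms ev unfolding germ_equivalent_def
    by (intro exI[of _ S] exI[of _ X] exI[of _ "\<lambda>m. c * m"])
      (auto simp: zero_prod_def intro: smooth_germ_bounded_linear bounded_linear_mult_right)
qed

text \<open>In the coordinate \<open>y = X\<close> the nontrivial zeros form the parabola
  \<open>y\<^sup>2 = c * (\<kappa> * m)\<close>; the branches are the images of its two halves under
  the fibrewise inverse \<open>Y\<close>. The sign \<open>\<kappa>\<close> selects the side.\<close>

lemma nontrivial_branches_onI:
  fixes X h :: "real \<times> real \<Rightarrow> real"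
  assumes "smooth_germ X" "ddx X 0 > 0" "c > 0" "\<kappa> \<in> {1, -1}"
    and "\<forall>\<^sub>F p in nhds 0. fst p = 0 \<longrightarrow> X p = 0"
    and "\<forall>\<^sub>F p in nhds 0. h p = 0 \<longleftrightarrow> X p = 0 \<or> (X p)\<^sup>2 = c * (\<kappa> * snd p)"
  shows "nontrivial_branches_on {m. \<kappa> * m > 0} h"
proof -
  let ?P = "\<lambda>p. (fst p = 0 \<longrightarrow> X p = 0) \<and> (h p = 0 \<longleftrightarrow> X p = 0 \<or> (X p)\<^sup>2 = c * (\<kappa> * snd p))"
  have ev: "\<forall>\<^sub>F p in nhds 0. ?P p"
    using assms(5,6) by (rule eventually_conj)
  obtain a V Y where a: "a > 0" and V: "open V" and "smooth_on V Y" and cont: "continuous_on V Y"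
    and box': "\<forall>x m. \<bar>x\<bar> < a \<longrightarrow> \<bar>m\<bar> < a \<longrightarrow> (X (x, m), m) \<in> V \<and> Y (X (x, m), m) = x \<and> ?P (x, m)"
    and inv': "\<forall>y m. (y, m) \<in> V \<longrightarrow> \<bar>Y (y, m)\<bar> < a \<and> \<bar>m\<bar> < a \<and> X (Y (y, m), m) = y"
    and mono': "\<forall>x x' m. \<bar>x\<bar> < a \<longrightarrow> \<bar>x'\<bar> < a \<longrightarrow> \<bar>m\<bar> < a \<longrightarrow> x < x' \<longrightarrow> X (x, m) < X (x', m)"
    by (rule local_fibrewise_inverse[OF assms(1,2) ev]) (rule that)
  note box = box'[rule_format] and inv = inv'[rule_format] and mono = mono'[rule_format]
  have Y0: "(0, m) \<in> V \<and> Y (0, m) = 0 \<and> X (0, m) = 0" if "\<bar>m\<bar> < a" for m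
    using box[of 0 m] that a by auto
  have "\<forall>\<^sub>F p in nhds 0. p \<in> V"
    using Y0[of 0] a V by (intro eventually_nhds_in_open) (auto simp: zero_prod_def)
  then obtain \<rho> where \<rho>: "\<rho> > 0" "\<And>y m. \<bar>y\<bar> < \<rho> \<Longrightarrow> \<bar>m\<bar> < \<rho> \<Longrightarrow> (y, m) \<in> V"
    by (blast dest: eventually_nhds_0_box)
  \<comment> \<open>The bound \<open>\<rho>\<^sup>2 / c\<close> keeps the square root
    \<open>w m\<close> below \<open>\<rho>\<close>, so that \<open>(- w m, m)\<close> and
    \<open>(w m, m)\<close> lie in \<open>V\<close>.\<close>
  define \<eta> where "\<eta> = min (min a \<rho>) (\<rho>\<^sup>2 / c)"
  have \<eta>: "\<eta> > 0" "\<eta> \<le> a" "\<eta> \<le> \<rho>"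
    using a \<rho>(1) assms(3) by (auto simp: \<eta>_def)
  have "\<eta> \<le> \<rho>\<^sup>2 / c"
    by (simp add: \<eta>_def)
  then have c\<eta>: "c * \<eta> \<le> \<rho>\<^sup>2"
    using assms(3) by (simp add: pos_le_divide_eq mult.commute)
  let ?side = "{m. \<kappa> * m > 0}"
  define w where "w = (\<lambda>m. sqrt (c * (\<kappa> * m)))"
  have w: "0 < w m" "w m < \<rho>" "\<bar>m\<bar> < \<rho>" "\<bar>m\<bar> < a" "(w m)\<^sup>2 = c * (\<kappa> * m)"
    if "m \<in> ?side \<inter> ball 0 \<eta>" for m
  proof -
    have m: "\<kappa> * m > 0" "\<bar>m\<bar> < \<eta>" "\<kappa> * m \<le> \<bar>m\<bar>"
      using that assms(4) by (auto simp: dist_norm)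
    then show "0 < w m" "\<bar>m\<bar> < \<rho>" "\<bar>m\<bar> < a" "(w m)\<^sup>2 = c * (\<kappa> * m)"
      using \<eta> assms(3) by (auto simp: w_def)
    have "c * (\<kappa> * m) < \<rho>\<^sup>2"
      using m c\<eta> assms(3) by (smt (verit) mult_less_cancel_left_pos)
    then show "w m < \<rho>"
      using \<rho>(1) by (simp add: w_def real_less_lsqrt)
  qed
  define x1 where "x1 = (\<lambda>m. Y (- w m, m))"
  define x2 where "x2 = (\<lambda>m. Y (w m, m))"
  have in_V: "(- w m, m) \<in> V" "(w m, m) \<in> V" if "m \<in> ?side \<inter> ball 0 \<eta>" for m
    using w[OF that] by (auto intro!: \<rho>(2))
  have cont_w: "continuous_on A w" for A
    unfolding w_def by (intro continuous_intros)
  have cont12: "continuous_on (?side \<inter> ball 0 \<eta>) x1" "continuous_on (?side \<inter> ball 0 \<eta>) x2"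
    unfolding x1_def x2_def
    by (intro continuous_on_compose2[OF cont] continuous_intros cont_w; use in_V in blast)+
  have contY0: "isCont Y (0, 0)"
    using cont V Y0[of 0] a continuous_on_eq_continuous_at by (metis abs_zero)
  have w0: "(w \<longlongrightarrow> 0) (at 0 within ?side)"
  proof -
    have "(w \<longlongrightarrow> sqrt (c * (\<kappa> * 0))) (at 0 within ?side)"
      unfolding w_def by (intro tendsto_intros)
    then show ?thesis
      by simp
  qed
  have lim: "(x1 \<longlongrightarrow> 0) (at 0 within ?side)" "(x2 \<longlongrightarrow> 0) (at 0 within ?side)"
  proof -
    have "((\<lambda>m. (- w m, m)) \<longlongrightarrow> (- 0, 0)) (at 0 within ?side)"
      "((\<lambda>m. (w m, m)) \<longlongrightarrow> (0, 0)) (at 0 within ?side)"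
      by (intro tendsto_intros w0)+
    then show "(x1 \<longlongrightarrow> 0) (at 0 within ?side)" "(x2 \<longlongrightarrow> 0) (at 0 within ?side)"
      using isCont_tendsto_compose[OF contY0] Y0[of 0] a unfolding x1_def x2_def by fastforce+
  qed
  have X12: "\<bar>x1 m\<bar> < a" "\<bar>x2 m\<bar> < a" "X (x1 m, m) = - w m" "X (x2 m, m) = w m"
    if "m \<in> ?side \<inter> ball 0 \<eta>" for m
    using inv[OF in_V(1)[OF that]] inv[OF in_V(2)[OF that]] by (auto simp: x1_def x2_def)
  \<comment> \<open>\<open>X\<close> vanishes at \<open>x = 0\<close> and increases in
    \<open>x\<close>, so the signs of \<open>- w m\<close> and \<open>w m\<close> carry over to the
    branches.\<close>
  have sign: "x1 m < 0 \<and> 0 < x2 m" if "m \<in> ?side \<inter> ball 0 \<eta>" for m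
    using X12[OF that] w[OF that] Y0[of m] mono[of 0 "x1 m" m] mono[of "x2 m" 0 m] a
    by (smt (verit))
  have zero: "h (x, m) = 0 \<longleftrightarrow> x = 0 \<or> m \<in> ?side \<and> (x = x1 m \<or> x = x2 m)"
    if "\<bar>x\<bar> < a \<and> \<bar>m\<bar> < \<eta>" for x m
  proof -
    have b: "\<bar>x\<bar> < a" "\<bar>m\<bar> < a"
      using that \<eta> by auto
    have X0: "X (x, m) = 0 \<longleftrightarrow> x = 0"
      using box[OF b] Y0[OF b(2)] by metis
    have eq: "h (x, m) = 0 \<longleftrightarrow> x = 0 \<or> (X (x, m))\<^sup>2 = c * (\<kappa> * m)"
      using box[OF b] X0 by simp
    show ?thesis
    proof (cases "m \<in> ?side")
      case True
      then have m: "m \<in> ?side \<inter> ball 0 \<eta>"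
        using that by (simp add: dist_norm)
      have "(X (x, m))\<^sup>2 = c * (\<kappa> * m) \<longleftrightarrow> X (x, m) = w m \<or> X (x, m) = - w m"
        using w(5)[OF m] power2_eq_iff by metis
      also have "\<dots> \<longleftrightarrow> x = x2 m \<or> x = x1 m"
        using box[OF b] X12[OF m] unfolding x1_def x2_def by metis
      finally show ?thesis
        using eq True by blast
    next
      case False
      then have "c * (\<kappa> * m) \<le> 0"
        using assms(3) by (simp add: mult_le_0_iff not_less)
      then have "(X (x, m))\<^sup>2 = c * (\<kappa> * m) \<Longrightarrow> X (x, m) = 0"
        by (metis power2_eq_iff_nonneg power2_less_eq_zero_iff)
      then show ?thesis
        using eq False X0 by blast
    qed
  qed
  show ?thesis
    unfolding nontrivial_branches_on_def using \<eta>(1) a cont12 lim sign zero by blast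
qed

section \<open>Classification of the reduced germ\<close>

lemma tangent_space_add:
  assumes "p \<in> tangent_space h" "q \<in> tangent_space h"
  shows "(\<lambda>x. p x + q x) \<in> tangent_space h"
proof -
  obtain a b c a' b' c' where sm: "smooth_germ a" "smooth_germ b" "smooth_germ c"
    "smooth_germ a'" "smooth_germ b'" "smooth_germ c'"
    and ev: "\<forall>\<^sub>F x in nhds 0. p x = a x * h x + b x * ddx h x + c (snd x) * ddmu h x"
    "\<forall>\<^sub>F x in nhds 0. q x = a' x * h x + b' x * ddx h x + c' (snd x) * ddmu h x"
    using assms unfolding tangent_space_def by blast
  have "\<forall>\<^sub>F x in nhds 0. p x + q x =
      (a x + a' x) * h x + (b x + b' x) * ddx h x + (c (snd x) + c' (snd x)) * ddmu h x"
    using ev by eventually_elim (simp add: algebra_simps)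
  then show ?thesis
    using smooth_germ_add[OF sm(1,4)] smooth_germ_add[OF sm(2,5)] smooth_germ_add[OF sm(3,6)]
    unfolding tangent_space_def by blast
qed

lemma tangent_space_cmult:
  fixes k :: real
  assumes "p \<in> tangent_space h"
  shows "(\<lambda>x. k * p x) \<in> tangent_space h"
proof -
  obtain a b c where sm: "smooth_germ a" "smooth_germ b" "smooth_germ c"
    and ev: "\<forall>\<^sub>F x in nhds 0. p x = a x * h x + b x * ddx h x + c (snd x) * ddmu h x"
    using assms unfolding tangent_space_def by blast
  have "\<forall>\<^sub>F x in nhds 0. k * p x =
      (k * a x) * h x + (k * b x) * ddx h x + (k * c (snd x)) * ddmu h x"
    using ev by eventually_elim (simp add: algebra_simps)
  then show ?thesis
    using sm[THEN smooth_germ_mult[OF smooth_germ_const[of k]]]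
    unfolding tangent_space_def by blast
qed

lemma smooth_germ_comp_snd:
  fixes c :: "real \<Rightarrow> real"
  assumes "smooth_germ c"
  shows "smooth_germ (\<lambda>p::real \<times> real. c (snd p))"
proof -
  obtain U where "open U" "0 \<in> U" "smooth_on U c"
    using assms by (auto simp: smooth_germ_def)
  then show ?thesis
    by (intro smooth_germ_compose[of snd U c] smooth_germ_bounded_linear bounded_linear_snd) auto
qed

text \<open>\<open>s\<close> stands for the voltage across the negative edge as a function of
  \<open>x\<close> and \<open>\<mu>\<close>. It is a fibre coordinate vanishing on the trivial
  branch, and \<open>h\<close> is known through \<open>s\<close> and \<open>g\<close>; this detaches
  the classification from the network.\<close>

locale reduced_germ =
  fixes g :: "real \<Rightarrow> real" and s h :: "real \<times> real \<Rightarrow> real" and r :: real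
  assumes smooth_g: "smooth_on UNIV g" and g_0: "g 0 = 0" and deriv_g_0: "deriv g 0 = 1"
    and smooth_s: "smooth_germ s" and s_trivial: "\<forall>\<^sub>F p in nhds 0. fst p = 0 \<longrightarrow> s p = 0"
    and ddx_s: "ddx s 0 > 0" and r_pos: "r > 0"
    and h_eq: "\<forall>\<^sub>F p in nhds 0. h p = s p - (1 + r * snd p) * g (s p)"
begin

lemma s_0: "s 0 = 0"
  using eventually_nhds_x_imp_x[OF s_trivial] by simp

lemma smooth_germ_comp_s: "smooth_on UNIV f \<Longrightarrow> smooth_germ (\<lambda>p. f (s p))"
  using smooth_germ_compose[OF smooth_s open_UNIV] by blast

lemma ddx_s_times:
  assumes "smooth_germ Q"
  shows "ddx (\<lambda>p. s p * Q p + c * snd p) 0 = ddx s 0 * Q 0"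
proof -
  have "((\<lambda>t. s (t, 0) * Q (t, 0) + c * snd (t, 0::real)) has_real_derivative ddx s 0 * Q 0) (at 0)"
    using s_0 by (auto intro!: derivative_eq_intros smooth_germ_has_ddx smooth_s assms simp: zero_prod_def)
  then show ?thesis
    unfolding zero_prod_def ddx_def by (auto intro: DERIV_imp_deriv)
qed

text \<open>Hadamard division twice: of \<open>g\<close>, and then of \<open>q - 1\<close>, which
  vanishes at 0 because the linear coefficient of \<open>g\<close> is 1.\<close>

lemma g_expansion:
  obtains e where "smooth_on UNIV e" "\<And>t. g t = t + t\<^sup>2 * e t"
    "e 0 = deriv (deriv g) 0 / 2" "deriv e 0 = deriv (deriv (deriv g)) 0 / 6"
proof -
  obtain q where q: "smooth_on UNIV q" "\<And>t. g t = t * q t" "q 0 = deriv g 0"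
    "deriv q 0 = deriv (deriv g) 0 / 2" "deriv (deriv q) 0 = deriv (deriv (deriv g)) 0 / 3"
    using hadamard_quotient[OF smooth_g g_0] by metis
  have "deriv (\<lambda>t. q t - 1) = deriv q"
    using smooth_on_has_real_derivative[OF q(1)]
    by (intro ext DERIV_imp_deriv) (auto intro!: derivative_eq_intros)
  moreover have "smooth_on UNIV (\<lambda>t. q t - 1)" "q 0 - 1 = 0"
    using q(1,3) deriv_g_0 by (auto intro: smooth_on_diff smooth_on_const)
  ultimately obtain e where e: "smooth_on UNIV e" "\<And>t. q t - 1 = t * e t"
    "e 0 = deriv q 0" "deriv e 0 = deriv (deriv q) 0 / 2"
    using hadamard_quotient[of "\<lambda>t. q t - 1"] by metis
  show ?thesis
  proof (rule that[OF e(1)])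
    show "g t = t + t\<^sup>2 * e t" for t
      using q(2)[of t] e(2)[of t] by (simp add: algebra_simps power2_eq_square)
  qed (use q e in auto)
qed

text \<open>With \<open>A = 1 + s * E\<close> the germ factors as
  \<open>h = - s * A * (s * E / A + r * \<mu>)\<close>. For \<open>y = s * E / A\<close> this is
  \<open>- (A\<^sup>2 / E) * y * (y + r * \<mu>)\<close>, and completing the square gives
  \<open>(y + r * \<mu> / 2)\<^sup>2 - (r * \<mu> / 2)\<^sup>2\<close>; hence \<open>X\<close> and
  the factor \<open>r / 2\<close>. The sign \<open>\<sigma>\<close> makes \<open>S\<close> and
  \<open>ddx X\<close> positive and reappears as \<open>\<epsilon> = - \<sigma>\<close>.\<close>

lemma transcritical_h:
  assumes "deriv (deriv g) 0 \<noteq> 0"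
  shows "transcritical h"
proof -
  obtain e where e: "smooth_on UNIV e" "\<And>t. g t = t + t\<^sup>2 * e t" "e 0 = deriv (deriv g) 0 / 2"
    using g_expansion by metis
  define \<sigma> where "\<sigma> = sgn (e 0)"
  have \<sigma>: "\<sigma> \<in> {1, -1}" "\<sigma> * e 0 > 0"
    using assms e(3) by (auto simp: \<sigma>_def sgn_if)
  define E where "E = (\<lambda>p. e (s p))"
  define A where "A = (\<lambda>p. 1 + s p * E p)"
  have sm: "smooth_germ E" "smooth_germ A"
    unfolding A_def E_def
    by (intro smooth_germ_add smooth_germ_mult smooth_germ_const smooth_s smooth_germ_comp_s e(1))+
  have at_0: "A 0 = 1" "E 0 = e 0"
    by (auto simp: A_def E_def s_0)
  have ev: "\<forall>\<^sub>F p in nhds 0. A p > 0" "\<forall>\<^sub>F p in nhds 0. \<sigma> * E p > 0"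
    by (intro eventually_nhds_pos smooth_germ_isCont smooth_germ_mult smooth_germ_const sm;
        use at_0 \<sigma> in simp)+
  define Q where "Q = (\<lambda>p. \<sigma> * (E p / A p))"
  define S where "S = (\<lambda>p. A p * A p / (\<sigma> * E p))"
  define X where "X = (\<lambda>p. s p * Q p + (\<sigma> * (r / 2)) * snd p)"
  have smQ: "smooth_germ Q"
    unfolding Q_def using at_0 by (intro smooth_germ_mult smooth_germ_divide smooth_germ_const sm) simp
  have "germ_equivalent h (\<lambda>(x, m). - \<sigma> * (x\<^sup>2 - m\<^sup>2))"
  proof (rule germ_equivalent_linear_parameterI[where S = S and X = X and c = "r / 2"])
    show "smooth_germ S"
      unfolding S_def using at_0 \<sigma>
      by (intro smooth_germ_divide smooth_germ_mult smooth_germ_const sm) auto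
    show "smooth_germ X"
      unfolding X_def
      by (intro smooth_germ_add smooth_germ_mult smooth_s smQ smooth_germ_const
          smooth_germ_bounded_linear[OF bounded_linear_snd])
    show "X 0 = 0" "S 0 > 0" "r / 2 > 0"
      using at_0 \<sigma> r_pos by (auto simp: X_def S_def s_0)
    show "ddx X 0 > 0"
      unfolding X_def ddx_s_times[OF smQ] using ddx_s at_0 \<sigma> by (auto simp: Q_def)
    show "\<forall>\<^sub>F p in nhds 0. h p = S p * (case (X p, r / 2 * snd p) of (x, m) \<Rightarrow> - \<sigma> * (x\<^sup>2 - m\<^sup>2))"
      using ev h_eq
    proof eventually_elim
      case (elim p)
      have nz: "A p \<noteq> 0" "E p \<noteq> 0"
        using elim by auto
      have \<sigma>2: "\<sigma> * \<sigma> = 1" "\<sigma> \<noteq> 0"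
        using \<sigma> by auto
      have "X p = \<sigma> * (s p * (E p / A p) + r / 2 * snd p)"
        by (simp add: X_def Q_def algebra_simps)
      then have "(X p)\<^sup>2 = (s p * (E p / A p) + r / 2 * snd p)\<^sup>2"
        using \<sigma>2(1) by (simp add: power_mult_distrib power2_eq_square[of \<sigma>])
      then have "(X p)\<^sup>2 - (r / 2 * snd p)\<^sup>2 = s p * (E p / A p) * (s p * (E p / A p) + r * snd p)"
        by (simp only: power2_eq_square) (simp add: algebra_simps)
      then have "S p * (- \<sigma> * ((X p)\<^sup>2 - (r / 2 * snd p)\<^sup>2)) =
          - (A p * A p / E p) * (s p * (E p / A p) * (s p * (E p / A p) + r * snd p))"
        using \<sigma>2(2) by (simp add: S_def)
      also have "\<dots> = - s p * (s p * E p + r * snd p * A p)"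
        using nz by (simp add: field_simps)
      also have "\<dots> = h p"
        using elim(3) by (simp add: A_def E_def e(2) power2_eq_square algebra_simps)
      finally show ?case
        by simp
    qed
  qed
  then show ?thesis
    using \<sigma>(1) unfolding transcritical_def by force
qed

text \<open>Now \<open>A = 1 + s\<^sup>2 * E\<close> and
  \<open>h = - s * A * (s\<^sup>2 * E / A + r * \<mu>)\<close>. The square root in \<open>Q\<close>
  is chosen so that \<open>X\<^sup>2 = \<sigma> * s\<^sup>2 * E / A\<close>, which leaves
  \<open>- \<sigma> * X ^ 3 - r * \<mu> * X\<close> times \<open>A / Q\<close>. Nontrivial zeros
  satisfy \<open>X\<^sup>2 = - \<sigma> * r * \<mu>\<close>, so the sign of the third derivative
  decides the side.\<close>

lemma pitchfork_h:
  assumes "deriv (deriv g) 0 = 0" "deriv (deriv (deriv g)) 0 \<noteq> 0"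
  shows "pitchfork h"
    and "nontrivial_branches_on {m. - sgn (deriv (deriv (deriv g)) 0) * m > 0} h"
proof -
  obtain e1 where e1: "smooth_on UNIV e1" "\<And>t. g t = t + t\<^sup>2 * e1 t" "e1 0 = 0"
    "deriv e1 0 = deriv (deriv (deriv g)) 0 / 6"
    using g_expansion assms(1) by (metis div_0)
  obtain e where e: "smooth_on UNIV e" "\<And>t. e1 t = t * e t" "e 0 = deriv (deriv (deriv g)) 0 / 6"
    using hadamard_quotient[OF e1(1,3)] e1(4) by metis
  define \<sigma> where "\<sigma> = sgn (deriv (deriv (deriv g)) 0)"
  have \<sigma>: "\<sigma> \<in> {1, -1}" "\<sigma> * e 0 > 0"
    using assms(2) e(3) by (auto simp: \<sigma>_def sgn_if)
  define E where "E = (\<lambda>p. e (s p))"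
  define A where "A = (\<lambda>p. 1 + s p * s p * E p)"
  have sm: "smooth_germ E" "smooth_germ A"
    unfolding A_def E_def
    by (intro smooth_germ_add smooth_germ_mult smooth_germ_const smooth_s smooth_germ_comp_s e(1))+
  have at_0: "A 0 = 1" "E 0 = e 0"
    by (auto simp: A_def E_def s_0)
  have ev: "\<forall>\<^sub>F p in nhds 0. A p > 0" "\<forall>\<^sub>F p in nhds 0. \<sigma> * E p > 0"
    by (intro eventually_nhds_pos smooth_germ_isCont smooth_germ_mult smooth_germ_const sm;
        use at_0 \<sigma> in simp)+
  define Q where "Q = (\<lambda>p. sqrt (\<sigma> * E p / A p))"
  define S where "S = (\<lambda>p. A p / Q p)"
  define X where "X = (\<lambda>p. s p * Q p)"
  have smQ: "smooth_germ Q"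
    unfolding Q_def using at_0 \<sigma>
    by (intro smooth_germ_sqrt smooth_germ_mult smooth_germ_divide smooth_germ_const sm) simp_all
  have Q_0: "Q 0 > 0"
    using at_0 \<sigma> by (simp add: Q_def)
  have smS: "smooth_germ S"
    unfolding S_def using Q_0 by (intro smooth_germ_divide sm smQ) simp
  have smX: "smooth_germ X"
    unfolding X_def by (intro smooth_germ_mult smooth_s smQ)
  have X_0: "X 0 = 0"
    by (simp add: X_def s_0)
  have S_0: "S 0 > 0"
    using Q_0 at_0 by (simp add: S_def)
  have ddx_X: "ddx X 0 > 0"
    using ddx_s_times[OF smQ, of 0] ddx_s Q_0 by (simp add: X_def)
  have h_eq': "\<forall>\<^sub>F p in nhds 0. h p = S p * (- \<sigma> * X p ^ 3 - r * snd p * X p) \<and> S p > 0"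
    using ev h_eq
  proof eventually_elim
    case (elim p)
    have Q: "Q p > 0" "Q p * Q p = \<sigma> * E p / A p"
      using elim by (auto simp: Q_def)
    have "\<sigma> * \<sigma> = 1"
      using \<sigma> by auto
    then have Q2: "\<sigma> * (Q p * Q p) * A p = E p"
      unfolding Q(2) using elim(1) by simp
    have "S p * (- \<sigma> * X p ^ 3 - r * snd p * X p) =
        - s p * (s p * s p * (\<sigma> * (Q p * Q p) * A p) + r * snd p * A p)"
      using Q(1) by (simp add: S_def X_def power3_eq_cube field_simps)
    also have "\<dots> = h p"
      using elim(3) unfolding Q2
      by (simp add: A_def E_def e1(2) e(2) power2_eq_square algebra_simps)
    finally show ?case
      using Q(1) elim(1) by (simp add: S_def)
  qed
  have "germ_equivalent h (\<lambda>(x, m). (- \<sigma>) * x ^ 3 + (- 1) * m * x)"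
    by (rule germ_equivalent_linear_parameterI[OF smS smX X_0 S_0 ddx_X r_pos])
      (use h_eq' in eventually_elim, simp)
  then show "pitchfork h"
    using \<sigma>(1) unfolding pitchfork_def by force
  have "\<forall>\<^sub>F p in nhds 0. h p = 0 \<longleftrightarrow> X p = 0 \<or> (X p)\<^sup>2 = r * (- \<sigma> * snd p)"
    using h_eq'
  proof eventually_elim
    case (elim p)
    then have "h p = 0 \<longleftrightarrow> - \<sigma> * X p ^ 3 - r * snd p * X p = 0"
      by simp
    also have "- \<sigma> * X p ^ 3 - r * snd p * X p = X p * (- \<sigma> * (X p)\<^sup>2 - r * snd p)"
      by (simp add: power2_eq_square power3_eq_cube algebra_simps)
    finally show ?case
      using \<sigma>(1) by auto
  qed
  moreover have "\<forall>\<^sub>F p in nhds 0. fst p = 0 \<longrightarrow> X p = 0"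
    using s_trivial by eventually_elim (simp add: X_def)
  moreover have "- \<sigma> \<in> {1, -1}"
    using \<sigma>(1) by auto
  ultimately show "nontrivial_branches_on {m. - sgn (deriv (deriv (deriv g)) 0) * m > 0} h"
    unfolding \<sigma>_def[symmetric] by (intro nontrivial_branches_onI[OF smX ddx_X r_pos])
qed

text \<open>On the axis \<open>x = 0\<close> membership in the tangent space forces the coefficient of \<open>1 - g'\<close> to
  vanish at the origin; on the axis \<open>\<mu> = 0\<close> one can then divide by \<open>s\<close> three times, reading off
  one coefficient each time.\<close>

lemma tangent_space_h_cubic:
  assumes "deriv (deriv g) 0 = 0" "deriv (deriv (deriv g)) 0 = 0"
    and tangent: "(\<lambda>p. \<beta>0 + \<beta>2 * (s p)\<^sup>2 + \<beta>3 * s p ^ 3) \<in> tangent_space h"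
  shows "\<beta>0 = 0" "\<beta>2 = 0" "\<beta>3 = 0"
proof -
  obtain e1 where e1: "smooth_on UNIV e1" "\<And>t. g t = t + t\<^sup>2 * e1 t" "e1 0 = 0" "deriv e1 0 = 0"
    using g_expansion assms(1,2) by (metis div_0)
  obtain e2 where e2: "smooth_on UNIV e2" "\<And>t. e1 t = t * e2 t" "e2 0 = 0"
    using hadamard_quotient[OF e1(1,3)] e1(4) by metis
  obtain e where e: "smooth_on UNIV e" "\<And>t. e2 t = t * e t"
    using hadamard_quotient[OF e2(1,3)] by metis
  \<comment> \<open>The two vanishing derivatives allow two further divisions. Hence
    \<open>t - g t\<close> has order at least 4 and \<open>1 - deriv g t\<close> order at least
    3.\<close>
  have g_eq: "g t = t + t ^ 4 * e t" for t
    by (simp add: e1(2) e2(2) e(2) power2_eq_square power4_eq_xxxx)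
  have "(g has_real_derivative 1 + t ^ 3 * (4 * e t + t * deriv e t)) (at t)" for t
    unfolding g_eq[abs_def]
    by (auto intro!: derivative_eq_intros smooth_on_has_real_derivative[OF e(1)]
        simp: power4_eq_xxxx power3_eq_cube algebra_simps)
  then have g': "deriv g t = 1 + t ^ 3 * (4 * e t + t * deriv e t)" for t
    by (rule DERIV_imp_deriv)
  obtain a b c where abc: "smooth_germ a" "smooth_germ b" "smooth_germ c"
    and eq: "\<forall>\<^sub>F p in nhds 0. \<beta>0 + \<beta>2 * (s p)\<^sup>2 + \<beta>3 * s p ^ 3 =
      a p * h p + b p * ddx h p + c (snd p) * ddmu h p"
    using tangent by (auto simp: tangent_space_def)
  obtain U where U: "open U" "0 \<in> U" "smooth_on U s"
    using smooth_s by (auto simp: smooth_germ_def)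
  obtain V where V: "open V" "0 \<in> V" "\<And>p. p \<in> V \<Longrightarrow> h p = s p - (1 + r * snd p) * g (s p)"
    using h_eq unfolding eventually_nhds by blast
  \<comment> \<open>\<open>h\<close> agrees with its formula near the origin only, so the chain rule
    is applied to the formula and transferred along each coordinate line.\<close>
  have dh: "ddx h p = (1 - (1 + r * snd p) * deriv g (s p)) * ddx s p"
    "ddmu h p = (1 - (1 + r * snd p) * deriv g (s p)) * ddmu s p - r * g (s p)"
    if "p \<in> U \<inter> V" for p
  proof -
    obtain x m where p: "p = (x, m)"
      by (cases p)
    have ev: "\<forall>\<^sub>F q in nhds (x, m). h q = s q - (1 + r * snd q) * g (s q)"
      using V that p by (auto simp: eventually_nhds)
    have tend: "((\<lambda>t. (t, m)) \<longlongrightarrow> (x, m)) (nhds x)" "((\<lambda>t. (x, t)) \<longlongrightarrow> (x, m)) (nhds m)"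
      by (intro tendsto_intros filterlim_ident)+
    have s_der: "((\<lambda>t. s (t, m)) has_real_derivative ddx s (x, m)) (at x)"
      "((\<lambda>t. s (x, t)) has_real_derivative ddmu s (x, m)) (at m)"
      using smooth_on_partial_derivatives(1,2)[OF U(3)] that p by auto
    note g_der = smooth_on_has_real_derivative[OF smooth_g UNIV_I, THEN DERIV_chain2]
    have "((\<lambda>t. s (t, m) - (1 + r * m) * g (s (t, m))) has_real_derivative
        (1 - (1 + r * m) * deriv g (s (x, m))) * ddx s (x, m)) (at x)"
      by (auto intro!: derivative_eq_intros g_der s_der simp: algebra_simps)
    then have "((\<lambda>t. h (t, m)) has_real_derivative
        (1 - (1 + r * m) * deriv g (s (x, m))) * ddx s (x, m)) (at x)"
      using filterlim_iff[THEN iffD1, OF tend(1), rule_format, OF ev]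
      by (subst DERIV_cong_ev[OF refl _ refl]) auto
    then show "ddx h p = (1 - (1 + r * snd p) * deriv g (s p)) * ddx s p"
      unfolding p by (auto simp: ddx_def intro: DERIV_imp_deriv)
    have "((\<lambda>t. s (x, t) - (1 + r * t) * g (s (x, t))) has_real_derivative
        (1 - (1 + r * m) * deriv g (s (x, m))) * ddmu s (x, m) - r * g (s (x, m))) (at m)"
      by (auto intro!: derivative_eq_intros g_der s_der simp: algebra_simps)
    then have "((\<lambda>t. h (x, t)) has_real_derivative
        (1 - (1 + r * m) * deriv g (s (x, m))) * ddmu s (x, m) - r * g (s (x, m))) (at m)"
      using filterlim_iff[THEN iffD1, OF tend(2), rule_format, OF ev]
      by (subst DERIV_cong_ev[OF refl _ refl]) auto
    then show "ddmu h p = (1 - (1 + r * snd p) * deriv g (s p)) * ddmu s p - r * g (s p)"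
      unfolding p by (auto simp: ddmu_def intro: DERIV_imp_deriv)
  qed
  \<comment> \<open>Both partial derivatives of \<open>h\<close> contain the factor
    \<open>1 - (1 + r * \<mu>) * deriv g s\<close>; \<open>B\<close> is its total
    coefficient.\<close>
  define B where "B = (\<lambda>p. b p * ddx s p + c (snd p) * ddmu s p)"
  have "smooth_germ (\<lambda>p::real \<times> real. c (snd p))"
    using abc(3) by (rule smooth_germ_comp_snd)
  then have smB: "smooth_germ B"
    unfolding B_def by (intro smooth_germ_add smooth_germ_mult abc smooth_germ_ddx_ddmu smooth_s)
  have "\<forall>\<^sub>F p in nhds 0. p \<in> U \<inter> V"
    using U V by (intro eventually_nhds_in_open) auto
  with eq have eq': "\<forall>\<^sub>F p in nhds 0. \<beta>0 + \<beta>2 * (s p)\<^sup>2 + \<beta>3 * s p ^ 3 =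
      a p * (s p - (1 + r * snd p) * g (s p)) + B p * (1 - (1 + r * snd p) * deriv g (s p))
      - c (snd p) * r * g (s p)"
  proof eventually_elim
    case (elim p)
    have hp: "h p = s p - (1 + r * snd p) * g (s p)"
      using elim(2) V(3) by simp
    show ?case
      unfolding elim(1) dh[OF elim(2)] hp by (simp add: B_def algebra_simps)
  qed
  have axes: "((\<lambda>m::real. (0, m)) \<longlongrightarrow> (0::real \<times> real)) (nhds 0)" "((\<lambda>x::real. (x, 0)) \<longlongrightarrow> (0::real \<times> real)) (nhds 0)"
    unfolding zero_prod_def by (intro tendsto_intros filterlim_ident)+
  note on_axes = axes[THEN filterlim_iff[THEN iffD1], rule_format]
  \<comment> \<open>With \<open>s = 0\<close> the terms in \<open>a\<close> and \<open>c\<close>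
    drop out, and the factor of \<open>B\<close> becomes \<open>- r * m\<close>.\<close>
  have "\<forall>\<^sub>F m in nhds 0. \<beta>0 = - r * m * B (0, m)"
    using on_axes(1)[OF eq'] on_axes(1)[OF s_trivial]
    by eventually_elim (simp add: g_0 deriv_g_0 algebra_simps)
  moreover from eventually_nhds_x_imp_x[OF this] show \<beta>0: "\<beta>0 = 0"
    by simp
  ultimately have ev0: "\<forall>\<^sub>F m in nhds 0. m ^ 1 * B (0, m) = 0"
    using r_pos by (auto elim!: eventually_mono)
  have cont_axes: "isCont (\<lambda>m. f (0, m)) 0" "isCont (\<lambda>x. f (x, 0)) 0" if "isCont f 0" for f :: "real \<times> real \<Rightarrow> real"
    using that by (auto intro!: continuous_intros isCont_o2[of _ _ f] simp: zero_prod_def)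
  \<comment> \<open>Replaces the comparison of Taylor coefficients: the power of \<open>t\<close>
    cancels away from 0, and only continuity of the cofactor is needed to pass to the limit.\<close>
  have vanish: "\<psi> 0 = 0"
    if "\<forall>\<^sub>F x in nhds 0. t x ^ n * \<psi> x = 0" "isCont \<psi> 0" "\<forall>\<^sub>F x in at 0. t x \<noteq> 0"
    for t \<psi> :: "real \<Rightarrow> real" and n
  proof -
    have "\<forall>\<^sub>F x in at 0. \<psi> x = 0"
      using that(3) eventually_at_filter[THEN iffD2] that(1)
      by (smt (verit, del_insts) eventually_at_filter eventually_elim2 mult_eq_0_iff power_not_zero)
    then have "(\<psi> \<longlongrightarrow> 0) (at 0)"
      by (rule tendsto_eventually)
    then show ?thesis
      using that(2) LIM_unique unfolding isCont_def by blast
  qed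
  have B_0: "B 0 = 0"
    using vanish[OF ev0 cont_axes(1)[OF smooth_germ_isCont[OF smB]]]
    by (simp add: zero_prod_def eventually_at_filter)
  let ?t = "\<lambda>x. s (x, 0)" and ?a = "\<lambda>x. a (x, 0)" and ?B = "\<lambda>x. B (x, 0)" and ?e = "\<lambda>x. e (s (x, 0))"
    and ?d = "\<lambda>x. deriv e (s (x, 0))"
  have cont: "isCont ?t 0" "isCont ?a 0" "isCont ?B 0" "isCont ?e 0" "isCont ?d 0"
    by (intro cont_axes(2) smooth_germ_isCont smooth_s abc smB smooth_germ_comp_s e(1) smooth_on_deriv open_UNIV)+
  have t_0: "?t 0 = 0" "?B 0 = 0"
    using s_0 B_0 by (simp_all add: zero_prod_def)
  have "\<forall>\<^sub>F x in at 0. (?t x - ?t 0) / (x - 0) > 0"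
    using smooth_germ_has_ddx[OF smooth_s] order_tendstoD(1) ddx_s
    unfolding has_field_derivative_iff by blast
  then have t_nz: "\<forall>\<^sub>F x in at 0. ?t x \<noteq> 0"
    by eventually_elim (use t_0 in auto)
  have eq_x: "\<forall>\<^sub>F x in nhds 0. \<beta>2 * (?t x)\<^sup>2 + \<beta>3 * ?t x ^ 3 + ?a x * ?t x ^ 4 * ?e x
      + ?B x * ?t x ^ 3 * (4 * ?e x + ?t x * ?d x) + c 0 * r * (?t x + ?t x ^ 4 * ?e x) = 0"
    using on_axes(2)[OF eq'] by eventually_elim (simp add: \<beta>0 g_eq g' algebra_simps)
  \<comment> \<open>The relation divided by the voltage. All terms but the last still vanish at 0,
    where \<open>c 0 * r\<close> remains.\<close>
  define \<psi>1 where "\<psi>1 = (\<lambda>x. \<beta>2 * ?t x + \<beta>3 * (?t x)\<^sup>2 + ?a x * ?t x ^ 3 * ?e x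
      + ?B x * (?t x)\<^sup>2 * (4 * ?e x + ?t x * ?d x) + c 0 * r * (1 + ?t x ^ 3 * ?e x))"
  have "\<psi>1 0 = 0"
  proof (rule vanish[OF _ _ t_nz])
    show "\<forall>\<^sub>F x in nhds 0. ?t x ^ 1 * \<psi>1 x = 0"
      using eq_x by eventually_elim
        (simp add: \<psi>1_def power2_eq_square power3_eq_cube power4_eq_xxxx algebra_simps)
    show "isCont \<psi>1 0"
      unfolding \<psi>1_def by (intro continuous_intros cont)
  qed
  then have c_0: "c 0 = 0"
    using t_0 r_pos by (simp add: \<psi>1_def)
  define \<psi>2 where "\<psi>2 = (\<lambda>x. \<beta>2 + \<beta>3 * ?t x + ?a x * (?t x)\<^sup>2 * ?e x
      + ?B x * ?t x * (4 * ?e x + ?t x * ?d x))"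
  have "\<psi>2 0 = 0"
  proof (rule vanish[OF _ _ t_nz])
    show "\<forall>\<^sub>F x in nhds 0. ?t x ^ 2 * \<psi>2 x = 0"
      using eq_x by eventually_elim
        (simp add: \<psi>2_def c_0 power2_eq_square power3_eq_cube power4_eq_xxxx algebra_simps)
    show "isCont \<psi>2 0"
      unfolding \<psi>2_def by (intro continuous_intros cont)
  qed
  then show \<beta>2: "\<beta>2 = 0"
    using t_0 by (simp add: \<psi>2_def)
  \<comment> \<open>At 0 there remain \<open>\<beta>3\<close> and \<open>4 * B 0 * e 0\<close>; the
    information \<open>B 0 = 0\<close> from the other axis removes the latter.\<close>
  define \<psi>3 where "\<psi>3 = (\<lambda>x. \<beta>3 + ?a x * ?t x * ?e x + ?B x * (4 * ?e x + ?t x * ?d x))"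
  have "\<psi>3 0 = 0"
  proof (rule vanish[OF _ _ t_nz])
    show "\<forall>\<^sub>F x in nhds 0. ?t x ^ 3 * \<psi>3 x = 0"
      using eq_x by eventually_elim
        (simp add: \<psi>3_def c_0 \<beta>2 power2_eq_square power3_eq_cube power4_eq_xxxx algebra_simps)
    show "isCont \<psi>3 0"
      unfolding \<psi>3_def by (intro continuous_intros cont)
  qed
  then show "\<beta>3 = 0"
    using t_0 by (simp add: \<psi>3_def)
qed

text \<open>If \<open>B\<close> spans the quotient, expanding \<open>1\<close>,
  \<open>s\<^sup>2\<close> and \<open>s ^ 3\<close> gives each germ in \<open>B\<close> a triple of
  coefficients. Fewer than three triples span a proper subspace of \<open>real ^ 3\<close>, and a
  nonzero \<open>y\<close> orthogonal to it yields a nontrivial combination of the three powers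
  inside the tangent space.\<close>

lemma germ_codim_h:
  assumes "deriv (deriv g) 0 = 0" "deriv (deriv (deriv g)) 0 = 0"
  shows "germ_codim h > 2"
proof -
  have "3 \<le> card B"
    if B: "finite B" "\<forall>q. smooth_germ q \<longrightarrow> (\<exists>c. (\<lambda>p. q p - (\<Sum>b\<in>B. c b * b p)) \<in> tangent_space h)"
    for B :: "(real \<times> real \<Rightarrow> real) set"
  proof (rule ccontr)
    assume "\<not> 3 \<le> card B"
    have sp: "\<exists>c. (\<lambda>p. s p ^ k - (\<Sum>b\<in>B. c b * b p)) \<in> tangent_space h" for k
      using B(2) smooth_germ_power[OF smooth_s] by blast
    obtain c0 c2 c3 where c: "(\<lambda>p. s p ^ 0 - (\<Sum>b\<in>B. c0 b * b p)) \<in> tangent_space h"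
      "(\<lambda>p. s p ^ 2 - (\<Sum>b\<in>B. c2 b * b p)) \<in> tangent_space h"
      "(\<lambda>p. s p ^ 3 - (\<Sum>b\<in>B. c3 b * b p)) \<in> tangent_space h"
      using sp[of 0] sp[of 2] sp[of 3] by blast
    define w :: "(real \<times> real \<Rightarrow> real) \<Rightarrow> real ^ 3" where "w = (\<lambda>b. vector [c0 b, c2 b, c3 b])"
    have "dim (w ` B) \<le> card (w ` B)"
      by (rule dim_le_card') (use B in auto)
    also have "\<dots> < 3"
      using card_image_le[OF B(1), of w] \<open>\<not> 3 \<le> card B\<close> by simp
    finally have "dim (w ` B) < DIM(real ^ 3)"
      by simp
    then obtain y where y: "y \<noteq> 0" "\<And>z. z \<in> span (w ` B) \<Longrightarrow> orthogonal y z"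
      using orthogonal_to_subspace_exists by blast
    have rel: "y $ 1 * c0 b + y $ 2 * c2 b + y $ 3 * c3 b = 0" if "b \<in> B" for b
      using y(2)[OF span_base[OF imageI[OF that]]]
      by (simp add: orthogonal_def inner_vec_def sum_3 w_def)
    have "(\<lambda>p. y $ 1 * (s p ^ 0 - (\<Sum>b\<in>B. c0 b * b p)) + y $ 2 * (s p ^ 2 - (\<Sum>b\<in>B. c2 b * b p))
        + y $ 3 * (s p ^ 3 - (\<Sum>b\<in>B. c3 b * b p))) \<in> tangent_space h"
      by (intro tangent_space_add tangent_space_cmult c)
    moreover have "y $ 1 * (s p ^ 0 - (\<Sum>b\<in>B. c0 b * b p)) + y $ 2 * (s p ^ 2 - (\<Sum>b\<in>B. c2 b * b p))
        + y $ 3 * (s p ^ 3 - (\<Sum>b\<in>B. c3 b * b p)) = y $ 1 + y $ 2 * (s p)\<^sup>2 + y $ 3 * s p ^ 3" for p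
    proof -
      have "y $ 1 * (\<Sum>b\<in>B. c0 b * b p) + y $ 2 * (\<Sum>b\<in>B. c2 b * b p) + y $ 3 * (\<Sum>b\<in>B. c3 b * b p)
          = (\<Sum>b\<in>B. (y $ 1 * c0 b + y $ 2 * c2 b + y $ 3 * c3 b) * b p)"
        by (simp add: sum_distrib_left sum.distrib algebra_simps)
      also have "\<dots> = 0"
        by (simp add: rel)
      finally show ?thesis
        by (simp add: algebra_simps)
    qed
    ultimately have "(\<lambda>p. y $ 1 + y $ 2 * (s p)\<^sup>2 + y $ 3 * s p ^ 3) \<in> tangent_space h"
      by simp
    from tangent_space_h_cubic[OF assms this] have "y = 0"
      by (simp add: vec_eq_iff forall_3)
    with y(1) show False ..
  qed
  then have "enat 3 \<le> germ_codim h"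
    unfolding germ_codim_def by (intro Inf_greatest) auto
  moreover have "(2::enat) < enat 3"
    by (simp add: numeral_eq_enat)
  ultimately show ?thesis
    by (rule order_less_le_trans[rotated])
qed

end

section \<open>Lyapunov--Schmidt reduction for a rank-one nonlinearity\<close>

lemma mem_ones_perp: "z \<in> ones_perp \<longleftrightarrow> z \<bullet> (\<chi> p. 1) = 0"
  by (simp add: ones_perp_def orthogonal_def)

lemma subspace_ones_perp: "subspace ones_perp"
  by (auto simp: subspace_def mem_ones_perp inner_add_left)

lemma orthogonal_projection_eq_0_iff:
  fixes S :: "'a::euclidean_space set"
  assumes "subspace S"
  shows "orthogonal_projection S x = 0 \<longleftrightarrow> (\<forall>s\<in>S. x \<bullet> s = 0)"
proof -
  have unique: "p = q" if "p \<in> S" "\<forall>s\<in>S. orthogonal (x - p) s" "q \<in> S" "\<forall>s\<in>S. orthogonal (x - q) s" for p q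
  proof -
    have "p - q \<in> S"
      using assms that by (simp add: subspace_diff)
    then have "(x - q) \<bullet> (p - q) - (x - p) \<bullet> (p - q) = 0"
      using that by (simp add: orthogonal_def)
    then have "(p - q) \<bullet> (p - q) = 0"
      by (simp add: inner_diff_left)
    then show ?thesis
      by simp
  qed
  obtain y z where yz: "y \<in> span S" "\<And>s. s \<in> span S \<Longrightarrow> orthogonal z s" "x = y + z"
    using orthogonal_subspace_decomp_exists[of S x] by blast
  have y: "y \<in> S" "\<forall>s\<in>S. orthogonal (x - y) s"
    using yz span_eq_iff[THEN iffD2, OF assms] by auto
  then have "orthogonal_projection S x = y"
    unfolding orthogonal_projection_def using unique by (intro the_equality) auto
  moreover have "y = 0 \<longleftrightarrow> (\<forall>s\<in>S. x \<bullet> s = 0)"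
    using y unique[OF y subspace_0[OF assms]] by (auto simp: orthogonal_def)
  ultimately show ?thesis
    by simp
qed

text \<open>The network seen abstractly: a symmetric map, injective on the complement of the
  all-ones vector, minus a nonlinearity along the single vector \<open>e\<close>. The graph matters
  only when these properties are verified.\<close>

locale lyapunov_schmidt =
  fixes K :: "real ^ 'n \<Rightarrow> real \<Rightarrow> real" and M :: "real ^ 'n ^ 'n::finite"
    and e v :: "real ^ 'n" and r :: real and g :: "real \<Rightarrow> real"
  assumes gradient_K: "gradient (\<lambda>w. K w k) z = M *v z - (k * g (e \<bullet> z)) *\<^sub>R e"
    and M_sym: "(M *v a) \<bullet> b = a \<bullet> (M *v b)"
    and M_perp: "M *v z \<in> ones_perp" and e_perp: "e \<in> ones_perp"
    and M_inj: "z \<in> ones_perp \<Longrightarrow> M *v z = 0 \<Longrightarrow> z = 0"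
    and v_perp: "v \<in> ones_perp" and M_v: "M *v v = e" and e_v: "e \<bullet> v = r" and r_pos: "r > 0"
    and smooth_g: "smooth_on UNIV g" and g_0: "g 0 = 0" and deriv_g_0: "deriv g 0 = 1"
begin

lemma e_eq: "e \<bullet> z = v \<bullet> (M *v z)"
  by (metis M_sym M_v)

lemma v_v: "v \<bullet> v > 0"
  using M_v e_v r_pos by (metis inner_gt_zero_iff inner_zero_right less_irrefl)

text \<open>As \<open>deriv g 0 = 1\<close>, the linearization is \<open>M\<close> minus
  \<open>k\<close> times the rank-one map of \<open>e\<close>. At \<open>k = inverse r\<close> it
  annihilates \<open>v\<close>, because \<open>M *v v = e\<close> and
  \<open>e \<bullet> v = r\<close>.\<close>

lemma hessian_K: "hessian (\<lambda>w. K w k) 0 *v z = M *v z - (k * (e \<bullet> z)) *\<^sub>R e"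
proof -
  let ?D = "\<lambda>d. M *v d - (k * (e \<bullet> d)) *\<^sub>R e"
  have g': "(g has_real_derivative 1) (at (e \<bullet> 0))"
    using smooth_on_has_real_derivative[OF smooth_g, of 0] deriv_g_0 by simp
  have "((\<lambda>z. g (e \<bullet> z)) has_derivative (\<lambda>d. (e \<bullet> d) * 1)) (at 0)"
    by (rule DERIV_compose_FDERIV[where g = "\<lambda>z. e \<bullet> z", OF g']) (auto intro!: derivative_eq_intros)
  moreover have "((*v) M has_derivative (*v) M) (at 0)"
    by (rule bounded_linear_imp_has_derivative) simp
  ultimately have D: "(gradient (\<lambda>w. K w k) has_derivative ?D) (at 0)"
    unfolding gradient_K[abs_def] by (auto intro!: derivative_eq_intros)
  then have "gradient (\<lambda>w. K w k) differentiable at 0"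
    by (rule differentiableI)
  from has_derivative_unique[OF iffD1[OF jacobian_works this] D] show ?thesis
    unfolding hessian_def by (rule fun_cong)
qed

text \<open>By dimension \<open>M\<close> maps the complement of the all-ones vector onto itself, so
  a left inverse there is also a right inverse. Linearity of \<open>A\<close> on the whole space
  makes \<open>W\<close> smooth in the ambient input variable.\<close>

lemma M_right_inverse:
  obtains A where "linear A" "\<And>u. u \<in> ones_perp \<Longrightarrow> A u \<in> ones_perp \<and> M *v A u = u"
proof -
  have lin: "linear ((*v) M)"
    by simp
  have inj: "inj_on ((*v) M) ones_perp"
    using M_inj by (auto simp: linear_injective_on_subspace_0[OF lin subspace_ones_perp])
  obtain A where A: "range A \<subseteq> ones_perp" "linear A" "\<forall>z\<in>ones_perp. A (M *v z) = z"
    using real_vector.linear_exists_left_inverse_on[OF lin subspace_ones_perp inj]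
    by (elim exE conjE) (rule that)
  have "(*v) M ` ones_perp = ones_perp"
  proof (rule subspace_dim_equal)
    show "subspace ((*v) M ` ones_perp)"
      by (rule linear_subspace_image[OF lin subspace_ones_perp])
    show "dim (ones_perp :: (real ^ 'n) set) \<le> dim ((*v) M ` ones_perp)"
      using inj by (subst eucl.dim_image_eq[OF lin])
        (simp_all add: span_eq_iff[THEN iffD2, OF subspace_ones_perp])
  qed (use subspace_ones_perp M_perp in auto)
  then have "A u \<in> ones_perp \<and> M *v A u = u" if "u \<in> ones_perp" for u
    using that A(1,3) by force
  with A(2) show ?thesis
    by (rule that)
qed

text \<open>The linearization is symmetric and kills \<open>v\<close>, so its image is orthogonal to
  \<open>v\<close>. Conversely, if \<open>y \<bullet> v = 0\<close> then \<open>A y\<close> has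
  voltage \<open>e \<bullet> A y = v \<bullet> y = 0\<close>, the rank-one term drops out, and
  \<open>A y\<close> is a preimage of \<open>y\<close>.\<close>

lemma linearization_image_eq: "linearization_image K (inverse r) = {y \<in> ones_perp. y \<bullet> v = 0}"
proof (intro equalityI subsetI)
  fix y assume "y \<in> linearization_image K (inverse r)"
  then obtain z where y: "y = M *v z - (inverse r * (e \<bullet> z)) *\<^sub>R e"
    by (auto simp: linearization_image_def hessian_K)
  have "y \<in> ones_perp"
    unfolding y by (intro subspace_diff subspace_ones_perp M_perp subspace_scale e_perp)
  moreover have "y \<bullet> v = 0"
    using r_pos by (simp add: y inner_diff_left M_sym M_v e_v inner_commute[of z e])
  ultimately show "y \<in> {y \<in> ones_perp. y \<bullet> v = 0}"
    by simp
next
  fix y assume y: "y \<in> {y \<in> ones_perp. y \<bullet> v = 0}"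
  obtain A where A: "\<And>u. u \<in> ones_perp \<Longrightarrow> A u \<in> ones_perp \<and> M *v A u = u"
    using M_right_inverse by blast
  then have "y = hessian (\<lambda>w. K w (inverse r)) 0 *v A y"
    using y by (simp add: hessian_K e_eq inner_commute)
  then show "y \<in> linearization_image K (inverse r)"
    using A y unfolding linearization_image_def by blast
qed

lemma subspace_linearization_image: "subspace (linearization_image K (inverse r))"
  unfolding linearization_image_eq using subspace_ones_perp
  by (auto simp: subspace_def inner_add_left)

lemma network_F_eq: "network_F K z u k = M *v z - (k * g (e \<bullet> z)) *\<^sub>R e - u"
  by (simp add: network_F_def gradient_K)

text \<open>Inside \<open>ones_perp\<close> the orthogonal complement of the image is the line
  through \<open>v\<close>. The projected equation thus becomes an unprojected one with a single
  scalar unknown \<open>c\<close>.\<close>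

lemma projected_eq_0_iff:
  assumes "y \<in> ones_perp"
  shows "orthogonal_projection (linearization_image K (inverse r)) y = 0 \<longleftrightarrow> (\<exists>c. y = c *\<^sub>R v)"
proof -
  have "\<exists>c. y = c *\<^sub>R v" if "\<forall>s\<in>linearization_image K (inverse r). y \<bullet> s = 0"
  proof -
    let ?c = "y \<bullet> v / (v \<bullet> v)"
    let ?d = "y - ?c *\<^sub>R v"
    have dv: "?d \<bullet> v = 0"
      using v_v by (simp add: inner_diff_left)
    have "?d \<in> ones_perp"
      by (intro subspace_diff subspace_ones_perp assms subspace_scale v_perp)
    with dv that have "y \<bullet> ?d = 0"
      by (simp add: linearization_image_eq)
    with dv have "?d \<bullet> ?d = 0"
      by (simp add: inner_diff_left inner_diff_right inner_commute)
    then show ?thesis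
      by (intro exI[of _ ?c]) simp
  qed
  then show ?thesis
    unfolding orthogonal_projection_eq_0_iff[OF subspace_linearization_image]
    by (auto simp: linearization_image_eq inner_commute)
qed

definition dual :: "real ^ 'n" where "dual = (SOME w. w \<in> ones_perp \<and> M *v w = v)"

lemma dual: "dual \<in> ones_perp" "M *v dual = v"
proof -
  have "\<exists>w. w \<in> ones_perp \<and> M *v w = v"
    using M_right_inverse v_perp by metis
  from someI_ex[OF this] show "dual \<in> ones_perp" "M *v dual = v"
    by (simp_all add: dual_def)
qed

lemma e_dual: "e \<bullet> dual = v \<bullet> v"
  by (simp add: e_eq dual)

text \<open>Pairing \<open>z\<close> with \<open>v\<close> leaves the term
  \<open>c * (v \<bullet> dual)\<close>. One factor \<open>v \<bullet> v\<close> in the denominator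
  comes from \<open>f = c * (v \<bullet> v)\<close>, the other from
  \<open>v \<bullet> z = x * (v \<bullet> v)\<close>.\<close>

definition \<alpha> :: real where "\<alpha> = (v \<bullet> dual) / (v \<bullet> v)\<^sup>2"

text \<open>The state variable \<open>x\<close> of the reduction, as a function of the voltage \<open>t\<close> across the negative edge.\<close>

definition amplitude :: "real \<Rightarrow> real \<Rightarrow> real" where
  "amplitude t k = k * g t + \<alpha> * (t - k * r * g t)"

lemma projected_solution:
  assumes "z \<in> ones_perp" "network_F K z 0 k = c *\<^sub>R v"
  shows "c * (v \<bullet> v) = e \<bullet> z - k * r * g (e \<bullet> z)"
    and "v \<bullet> z = (v \<bullet> v) * amplitude (e \<bullet> z) k"
proof -
  let ?z = "(k * g (e \<bullet> z)) *\<^sub>R v + c *\<^sub>R dual"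
  have "M *v (z - ?z) = 0"
    using assms(2) by (simp add: network_F_eq matrix_vector_mult_diff_distrib
        matrix_vector_right_distrib matrix_vector_mult_scaleR M_v dual algebra_simps)
  moreover have "z - ?z \<in> ones_perp"
    by (intro subspace_diff subspace_add subspace_scale subspace_ones_perp assms v_perp dual)
  ultimately have z: "z = ?z"
    using M_inj by (metis eq_iff_diff_eq_0)
  have "e \<bullet> z = k * g (e \<bullet> z) * r + c * (v \<bullet> v)"
    by (subst z) (simp add: inner_add_right e_v e_dual)
  then show c: "c * (v \<bullet> v) = e \<bullet> z - k * r * g (e \<bullet> z)"
    by (simp add: algebra_simps)
  have "v \<bullet> z = k * g (e \<bullet> z) * (v \<bullet> v) + c * (v \<bullet> dual)"
    by (subst z) (simp add: inner_add_right)
  also have "c * (v \<bullet> dual) = (v \<bullet> v) * (\<alpha> * (c * (v \<bullet> v)))"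
    using v_v by (simp add: \<alpha>_def power2_eq_square)
  finally show "v \<bullet> z = (v \<bullet> v) * amplitude (e \<bullet> z) k"
    unfolding c by (simp add: amplitude_def algebra_simps)
qed

text \<open>Every admissible \<open>W\<close> obeys the closed formulas, with \<open>s\<close> the
  voltage of the solved state. Dividing the amplitude relation by \<open>s\<close> gives
  \<open>x = s * a\<close> with \<open>a 0 = inverse r\<close>; from this follow both the vanishing
  of \<open>s\<close> at \<open>x = 0\<close> and \<open>ddx s 0 = r\<close>.\<close>

lemma LS_reduced_germ:
  assumes "LS_implicit_function K B v (inverse r) W"
  shows "\<exists>s. reduced_germ g s (bifurcation_germ K v (inverse r) W) r"
proof -
  obtain U where W_0: "W (0, 0, inverse r) = 0" and U: "open U" "(0, 0, inverse r) \<in> U" "smooth_on U W"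
    and W: "\<And>x u k. (x, u, k) \<in> U \<Longrightarrow> u \<in> boundary_inputs B \<Longrightarrow>
      W (x, u, k) \<in> linearization_image K (inverse r) \<and>
      orthogonal_projection (linearization_image K (inverse r))
        (network_F K (x *\<^sub>R v + W (x, u, k)) u k) = 0"
    using assms unfolding LS_implicit_function_def by blast
  have zero_input: "0 \<in> boundary_inputs B"
    by (simp add: boundary_inputs_def mem_ones_perp coordinate_subspace_def)
  define \<iota> :: "real \<times> real \<Rightarrow> real \<times> (real ^ 'n) \<times> real" where
    "\<iota> = (\<lambda>p. (fst p, 0, inverse r + snd p))"
  have sm\<iota>: "smooth_germ \<iota>"
    unfolding \<iota>_def
    by (intro smooth_germI[OF open_UNIV UNIV_I] smooth_on_Pair smooth_on_add smooth_on_const open_UNIV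
        smooth_on_bounded_linear bounded_linear_fst bounded_linear_snd)
  have \<iota>_0: "\<iota> 0 = (0, 0, inverse r)"
    by (simp add: \<iota>_def)
  have smW: "smooth_germ (\<lambda>p. W (\<iota> p))"
    by (rule smooth_germ_compose[OF sm\<iota> U(1,3)]) (simp add: \<iota>_0 U)
  define z where "z = (\<lambda>p. fst p *\<^sub>R v + W (\<iota> p))"
  define s where "s = (\<lambda>p. e \<bullet> z p)"
  have smz: "smooth_germ z"
    unfolding z_def
    by (intro smooth_germ_add smW smooth_germ_bounded_linear
        bounded_linear_scaleR_left[THEN bounded_linear_compose] bounded_linear_fst)
  have sms: "smooth_germ s"
    unfolding s_def by (rule smooth_germ_linear_compose[OF bounded_linear_inner_right smz])
  have s_0: "s 0 = 0"
    by (simp add: s_def z_def \<iota>_0 W_0)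
  have "((\<lambda>p. \<iota> p) \<longlongrightarrow> \<iota> 0) (nhds 0)"
    using smooth_germ_isCont[OF sm\<iota>] unfolding isCont_def by (simp add: tendsto_at_iff_tendsto_nhds)
  then have "\<forall>\<^sub>F p in nhds 0. \<iota> p \<in> U"
    using U by (intro topological_tendstoD) (auto simp: \<iota>_0)
  then have solved: "\<forall>\<^sub>F p in nhds 0.
      bifurcation_germ K v (inverse r) W p = s p - (1 + r * snd p) * g (s p) \<and>
      fst p = amplitude (s p) (inverse r + snd p)"
  proof eventually_elim
    case (elim p)
    let ?k = "inverse r + snd p"
    have Wp: "W (\<iota> p) \<in> ones_perp" "v \<bullet> W (\<iota> p) = 0"
      and proj: "orthogonal_projection (linearization_image K (inverse r)) (network_F K (z p) 0 ?k) = 0"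
      using W[of "fst p" 0 ?k] zero_input elim
      by (auto simp: \<iota>_def z_def linearization_image_eq inner_commute)
    have zp: "z p \<in> ones_perp"
      unfolding z_def by (intro subspace_add subspace_scale subspace_ones_perp v_perp Wp)
    have "network_F K (z p) 0 ?k \<in> ones_perp"
      unfolding network_F_eq diff_zero
      by (intro subspace_diff subspace_scale subspace_ones_perp M_perp e_perp)
    with proj obtain c where c: "network_F K (z p) 0 ?k = c *\<^sub>R v"
      using projected_eq_0_iff by blast
    have "bifurcation_germ K v (inverse r) W p = v \<bullet> network_F K (z p) 0 ?k"
      by (cases p) (simp add: bifurcation_germ_def LS_reduced_def z_def \<iota>_def)
    also have "\<dots> = c * (v \<bullet> v)"
      by (simp add: c)
    also have "\<dots> = s p - (1 + r * snd p) * g (s p)"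
      unfolding projected_solution(1)[OF zp c] s_def using r_pos by (simp add: field_simps)
    finally have 1: "bifurcation_germ K v (inverse r) W p = s p - (1 + r * snd p) * g (s p)" .
    have "v \<bullet> z p = fst p * (v \<bullet> v)"
      by (simp add: z_def inner_add_right Wp)
    then have "fst p = amplitude (s p) ?k"
      using projected_solution(2)[OF zp c] v_v by (simp add: s_def)
    with 1 show ?case ..
  qed
  obtain q where q: "smooth_on UNIV q" "\<And>t. g t = t * q t" "q 0 = 1"
    using hadamard_quotient[OF smooth_g g_0] deriv_g_0 by metis
  define a where "a = (\<lambda>p. (inverse r + snd p) * q (s p) + \<alpha> * (1 - (inverse r + snd p) * r * q (s p)))"
  have sma: "smooth_germ a"
    unfolding a_def
    by (intro smooth_germ_add smooth_germ_diff smooth_germ_mult smooth_germ_const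
        smooth_germ_bounded_linear[OF bounded_linear_snd] smooth_germ_compose[OF sms open_UNIV q(1) UNIV_I])
  have a_0: "a 0 = inverse r"
    using r_pos by (simp add: a_def s_0 q)
  have fst_eq: "\<forall>\<^sub>F p in nhds 0. fst p = s p * a p"
    using solved by eventually_elim (simp add: amplitude_def a_def q(2) algebra_simps)
  have "\<forall>\<^sub>F p in nhds 0. fst p = 0 \<longrightarrow> s p = 0"
  proof -
    have "\<forall>\<^sub>F p in nhds 0. a p > 0"
      by (rule eventually_nhds_pos[OF smooth_germ_isCont[OF sma]]) (simp add: a_0 r_pos)
    with fst_eq show ?thesis
      by eventually_elim auto
  qed
  moreover have "ddx s 0 > 0"
  proof -
    have der: "((\<lambda>t. s (t, 0) * a (t, 0)) has_real_derivative ddx s 0 * inverse r) (at 0)"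
      using s_0 a_0 by (auto intro!: derivative_eq_intros smooth_germ_has_ddx sms sma simp: zero_prod_def)
    have lim: "((\<lambda>x::real. (x, 0::real)) \<longlongrightarrow> 0) (nhds 0)"
      unfolding zero_prod_def by (intro tendsto_intros filterlim_ident)
    have "\<forall>\<^sub>F t in nhds 0. s (t, 0) * a (t, 0) = t"
      using filterlim_iff[THEN iffD1, rule_format, OF lim fst_eq] by eventually_elim simp
    from iffD1[OF DERIV_cong_ev[OF refl this refl] der]
    have "((\<lambda>t. t) has_real_derivative ddx s 0 * inverse r) (at 0)" .
    then have "ddx s 0 * inverse r = 1"
      using DERIV_ident DERIV_unique by blast
    then show ?thesis
      using r_pos by (simp add: field_simps)
  qed
  moreover have "\<forall>\<^sub>F p in nhds 0. bifurcation_germ K v (inverse r) W p = s p - (1 + r * snd p) * g (s p)"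
    using solved by eventually_elim simp
  ultimately show ?thesis
    using smooth_g g_0 deriv_g_0 sms r_pos by (intro exI[of _ s] reduced_germ.intro)
qed

text \<open>With an input \<open>u\<close>, the equation \<open>M z = k g(s) e + c v + u\<close>
  suggests \<open>z = k g(s) v + c dual + A u\<close>. The consistency condition
  \<open>e \<bullet> z = s\<close> determines \<open>c\<close>, and \<open>v \<bullet> W = 0\<close>
  becomes the scalar equation \<open>amplitude s k = x + \<l> \<bullet> u\<close>, solved for
  \<open>s\<close> by the fibrewise inverse.\<close>

lemma LS_implicit_function_exists: "\<exists>W. LS_implicit_function K B v (inverse r) W"
proof -
  define X where "X = (\<lambda>p. amplitude (fst p) (inverse r + snd p))"
  have "smooth_germ X"
    unfolding X_def amplitude_def
    by (intro smooth_germ_add smooth_germ_diff smooth_germ_mult smooth_germ_const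
        smooth_germ_compose[OF _ open_UNIV smooth_g UNIV_I] smooth_germ_bounded_linear
        bounded_linear_fst bounded_linear_snd)
  moreover have "ddx X 0 > 0"
  proof -
    have "((\<lambda>t. X (t, 0)) has_real_derivative inverse r) (at 0)"
      unfolding X_def amplitude_def
      using smooth_on_has_real_derivative[OF smooth_g UNIV_I, of 0] deriv_g_0 r_pos
      by (auto intro!: derivative_eq_intros)
    then have "ddx X 0 = inverse r"
      unfolding zero_prod_def ddx_def by (auto intro: DERIV_imp_deriv)
    then show ?thesis
      using r_pos by simp
  qed
  moreover have "\<forall>\<^sub>F p in nhds (0::real \<times> real). True"
    by simp
  ultimately obtain a V Y where a: "a > 0" and V: "open V" "smooth_on V Y" and "continuous_on V Y"
    and box: "\<forall>x m. \<bar>x\<bar> < a \<longrightarrow> \<bar>m\<bar> < a \<longrightarrow> (X (x, m), m) \<in> V \<and> Y (X (x, m), m) = x \<and> True"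
    and inv: "\<forall>y m. (y, m) \<in> V \<longrightarrow> \<bar>Y (y, m)\<bar> < a \<and> \<bar>m\<bar> < a \<and> X (Y (y, m), m) = y"
    and "\<forall>x x' m. \<bar>x\<bar> < a \<longrightarrow> \<bar>x'\<bar> < a \<longrightarrow> \<bar>m\<bar> < a \<longrightarrow> x < x' \<longrightarrow> X (x, m) < X (x', m)"
    by (rule local_fibrewise_inverse) (rule that)
  have Y_0: "(0, 0) \<in> V" "Y (0, 0) = 0"
    using box[rule_format, of 0 0] a by (auto simp: X_def amplitude_def g_0)
  obtain A where A: "linear A" "\<And>u. u \<in> ones_perp \<Longrightarrow> A u \<in> ones_perp \<and> M *v A u = u"
    using M_right_inverse by blast
  have blA: "bounded_linear A"
    using A(1) by (simp add: linear_conv_bounded_linear)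
  \<comment> \<open>The input changes \<open>v \<bullet> z\<close> directly by
    \<open>v \<bullet> A u = dual \<bullet> u\<close>, and through \<open>c\<close> by a multiple of
    \<open>v \<bullet> u\<close>. Both are moved to the side of \<open>x\<close> and divided by
    \<open>v \<bullet> v\<close>.\<close>
  define \<l> where "\<l> = \<alpha> *\<^sub>R v - (1 / (v \<bullet> v)) *\<^sub>R dual"
  define \<pi> :: "real \<times> (real ^ 'n) \<times> real \<Rightarrow> real \<times> real" where
    "\<pi> = (\<lambda>q. (fst q + \<l> \<bullet> fst (snd q), snd (snd q) - inverse r))"
  define U where "U = \<pi> -` V"
  have cont\<pi>: "continuous_on UNIV \<pi>"
    unfolding \<pi>_def by (intro continuous_intros)
  then have "open U"
    unfolding U_def using V(1) continuous_on_open_vimage[OF open_UNIV] by auto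
  define s where "s = (\<lambda>q. Y (\<pi> q))"
  define c where "c = (\<lambda>q. (s q - snd (snd q) * r * g (s q) - v \<bullet> fst (snd q)) / (v \<bullet> v))"
  define z where "z = (\<lambda>q. (snd (snd q) * g (s q)) *\<^sub>R v + c q *\<^sub>R dual + A (fst (snd q)))"
  define W where "W = (\<lambda>q. z q - fst q *\<^sub>R v)"
  note proj = bounded_linear_fst bounded_linear_snd bounded_linear_compose[OF bounded_linear_fst bounded_linear_snd]
    bounded_linear_compose[OF bounded_linear_snd bounded_linear_snd]
  have sm\<pi>: "smooth_on U \<pi>"
    unfolding \<pi>_def
    by (intro smooth_on_Pair smooth_on_add smooth_on_diff smooth_on_const \<open>open U\<close>
        smooth_on_linear_compose[OF _ bounded_linear_inner_right] smooth_on_bounded_linear proj)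
  have sms: "smooth_on U s"
    unfolding s_def by (rule smooth_on_compose[OF \<open>open U\<close> V(1) sm\<pi> V(2)]) (auto simp: U_def)
  have smgs: "smooth_on U (\<lambda>q. g (s q))"
    by (rule smooth_on_compose[OF \<open>open U\<close> open_UNIV sms smooth_g]) simp
  have smc: "smooth_on U c"
    unfolding c_def using v_v
    by (intro smooth_on_divide smooth_on_diff smooth_on_mult smooth_on_const \<open>open U\<close> sms smgs
        smooth_on_linear_compose[OF _ bounded_linear_inner_right] smooth_on_bounded_linear proj) simp
  have smW: "smooth_on U W"
    unfolding W_def z_def
    by (intro smooth_on_diff smooth_on_add smooth_on_scaleR smooth_on_mult smooth_on_const \<open>open U\<close> smgs smc
        smooth_on_linear_compose[OF _ blA] smooth_on_bounded_linear proj)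
  have main: "W (x, u, k) \<in> linearization_image K (inverse r) \<and>
      orthogonal_projection (linearization_image K (inverse r))
        (network_F K (x *\<^sub>R v + W (x, u, k)) u k) = 0"
    if q: "(x, u, k) \<in> U" and u: "u \<in> boundary_inputs B" for x u k
  proof -
    let ?s = "s (x, u, k)" and ?c = "c (x, u, k)" and ?z = "z (x, u, k)"
    have Au: "A u \<in> ones_perp" "M *v A u = u"
      using u A(2) by (auto simp: boundary_inputs_def)
    have vAu: "v \<bullet> A u = dual \<bullet> u"
      using M_sym[of dual "A u"] by (simp add: dual Au)
    have eAu: "e \<bullet> A u = v \<bullet> u"
      by (simp add: e_eq Au)
    have z: "?z = (k * g ?s) *\<^sub>R v + ?c *\<^sub>R dual + A u"
      by (simp add: z_def)
    have c: "?c * (v \<bullet> v) = ?s - k * r * g ?s - v \<bullet> u"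
      using v_v by (simp add: c_def)
    have "amplitude ?s k = x + \<l> \<bullet> u"
      using inv[rule_format, of "x + \<l> \<bullet> u" "k - inverse r"] q
      by (simp add: U_def s_def \<pi>_def X_def)
    then have amp: "(v \<bullet> v) * amplitude ?s k = (v \<bullet> v) * x + (v \<bullet> v) * \<alpha> * (v \<bullet> u) - dual \<bullet> u"
      using v_v by (simp add: \<l>_def inner_diff_left distrib_left right_diff_distrib)
    have "?c * (v \<bullet> dual) = (v \<bullet> v) * (\<alpha> * (?c * (v \<bullet> v)))"
      using v_v by (simp add: \<alpha>_def power2_eq_square)
    then have "v \<bullet> ?z = (v \<bullet> v) * amplitude ?s k - (v \<bullet> v) * \<alpha> * (v \<bullet> u) + dual \<bullet> u"
      unfolding c by (simp add: z inner_add_right vAu amplitude_def algebra_simps)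
    then have "v \<bullet> W (x, u, k) = 0"
      unfolding amp by (simp add: W_def inner_diff_right)
    moreover have zp: "?z \<in> ones_perp"
      unfolding z by (intro subspace_add subspace_scale subspace_ones_perp v_perp dual Au)
    then have "W (x, u, k) \<in> ones_perp"
      unfolding W_def by (intro subspace_diff subspace_scale subspace_ones_perp v_perp)
    ultimately have 1: "W (x, u, k) \<in> linearization_image K (inverse r)"
      by (simp add: linearization_image_eq inner_commute)
    have "e \<bullet> ?z = k * g ?s * r + ?c * (v \<bullet> v) + v \<bullet> u"
      by (simp add: z inner_add_right e_v e_dual eAu)
    then have "e \<bullet> ?z = ?s"
      unfolding c by simp
    then have "network_F K ?z u k = ?c *\<^sub>R v"
      unfolding network_F_eq
      by (simp add: z matrix_vector_right_distrib matrix_vector_mult_scaleR M_v dual Au)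
    then have "orthogonal_projection (linearization_image K (inverse r)) (network_F K ?z u k) = 0"
      using projected_eq_0_iff subspace_scale[OF subspace_ones_perp v_perp] by metis
    with 1 show ?thesis
      by (simp add: W_def)
  qed
  have \<pi>_0: "\<pi> (0, 0, inverse r) = (0, 0)"
    by (simp add: \<pi>_def)
  have "W (0, 0, inverse r) = 0"
    using linear_0[OF A(1)] by (simp add: W_def z_def c_def s_def \<pi>_0 Y_0 g_0)
  moreover have "(0, 0, inverse r) \<in> U"
    by (simp add: U_def \<pi>_0 Y_0)
  moreover have "\<forall>x u k. (x, u, k) \<in> U \<and> u \<in> boundary_inputs B \<longrightarrow>
      W (x, u, k) \<in> linearization_image K (inverse r) \<and>
      orthogonal_projection (linearization_image K (inverse r))
        (network_F K (x *\<^sub>R v + W (x, u, k)) u k) = 0"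
    using main by simp
  ultimately show ?thesis
    unfolding LS_implicit_function_def using \<open>open U\<close> smW
    by (intro exI[of _ W] exI[of _ U] conjI)
qed

end

section \<open>Networks with one negative edge\<close>

locale signed_network =
  fixes N :: "('n::finite, 'm::finite) pre_digraph" and neg :: 'm
    and R :: "'m \<Rightarrow> real" and G :: "real \<Rightarrow> real"
  assumes verts: "verts N = UNIV" and arcs: "arcs N = UNIV" and loopfree: "loopfree_digraph N"
    and R_pos: "\<And>l. l \<noteq> neg \<Longrightarrow> R l > 0"
    and connected: "Digraph_Component.connected (pre_digraph.del_arc N neg)"
begin

abbreviation "M \<equiv> laplacian_without N neg R"

abbreviation edge :: "'m \<Rightarrow> real ^ 'n" where
  "edge l \<equiv> axis (tail N l) 1 - axis (head N l) 1"

text \<open>On a self-loop the nested conditional would give 1 at the node, the difference of unit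
  vectors 0; loop-freeness excludes the discrepancy.\<close>

lemma incidence_eq: "incidence N $ p $ l = edge l $ p"
  using loopfree_digraph.no_loops[OF loopfree, of l] arcs
  by (auto simp: incidence_def axis_def)

lemma edge_voltages_eq: "edge_voltages N z $ l = edge l \<bullet> z"
  by (simp add: edge_voltages_def matrix_vector_mult_def transpose_def incidence_eq inner_vec_def)

text \<open>A weighted sum of rank-one maps, one for each positive edge; symmetry, positivity and
  the range can be read off termwise.\<close>

lemma laplacian_mult: "M *v z = (\<Sum>l\<in>UNIV - {neg}. (inverse (R l) * (edge l \<bullet> z)) *\<^sub>R edge l)"
  unfolding vec_eq_iff
proof
  fix p
  have "(M *v z) $ p =
      (\<Sum>q\<in>UNIV. \<Sum>l\<in>UNIV - {neg}. inverse (R l) * edge l $ p * edge l $ q * z $ q)"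
    by (simp add: matrix_vector_mult_def laplacian_without_def incidence_eq sum_distrib_right)
  also have "\<dots> = (\<Sum>l\<in>UNIV - {neg}. \<Sum>q\<in>UNIV. inverse (R l) * edge l $ p * edge l $ q * z $ q)"
    by (rule sum.swap)
  also have "\<dots> = (\<Sum>l\<in>UNIV - {neg}. (inverse (R l) * (edge l \<bullet> z)) * edge l $ p)"
    unfolding inner_vec_def
    by (intro sum.cong refl) (simp add: sum_distrib_left sum_distrib_right mult_ac del: vector_minus_component)
  finally show "(M *v z) $ p = (\<Sum>l\<in>UNIV - {neg}. (inverse (R l) * (edge l \<bullet> z)) *\<^sub>R edge l) $ p"
    by simp
qed

lemma laplacian_inner:
  "(M *v z) \<bullet> w = (\<Sum>l\<in>UNIV - {neg}. inverse (R l) * (edge l \<bullet> z) * (edge l \<bullet> w))"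
  unfolding laplacian_mult by (simp add: inner_sum_left)

lemma laplacian_sym: "(M *v z) \<bullet> w = z \<bullet> (M *v w)"
  unfolding inner_commute[of z] laplacian_inner by (simp add: mult_ac)

lemma edge_perp: "edge l \<in> ones_perp"
  by (simp add: mem_ones_perp inner_diff_left inner_axis' )

lemma laplacian_perp: "M *v z \<in> ones_perp"
  unfolding laplacian_mult by (intro subspace_sum subspace_scale subspace_ones_perp edge_perp)

lemma laplacian_inner_eq_0:
  assumes "(M *v z) \<bullet> z = 0" "l \<noteq> neg"
  shows "edge l \<bullet> z = 0"
proof -
  have "inverse (R l) * (edge l \<bullet> z) * (edge l \<bullet> z) = 0"
    using assms R_pos unfolding laplacian_inner mult.assoc
    by (subst (asm) sum_nonneg_eq_0_iff) (auto simp: less_imp_le)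
  then show ?thesis
    using R_pos[OF assms(2)] by simp
qed

text \<open>Zero energy forces zero voltage on every positive edge, so \<open>z\<close> is constant
  along paths that traverse these edges in either direction. Connectivity without the negative edge
  joins any two nodes by such a path.\<close>

lemma laplacian_kernel_constant:
  assumes "(M *v z) \<bullet> z = 0"
  shows "z $ p = z $ q"
proof -
  let ?N' = "pre_digraph.del_arc N neg"
  have N': "verts ?N' = UNIV" "arcs ?N' = UNIV - {neg}" "tail ?N' = tail N" "head ?N' = head N"
    using verts arcs by (simp_all add: pre_digraph.del_arc_def)
  have "p \<rightarrow>\<^sup>*\<^bsub>with_proj (mk_symmetric ?N')\<^esub> q"
    using connected N' unfolding Digraph_Component.connected_def strongly_connected_def by simp
  then have "(p, q) \<in> (parcs (mk_symmetric ?N'))\<^sup>*"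
    using reachable_rtranclI[where G = "with_proj (mk_symmetric (pre_digraph.del_arc N neg))"] by simp
  then show ?thesis
  proof (induction rule: rtrancl_induct)
    case (step x y)
    then obtain l where "l \<noteq> neg" "(x, y) = (tail N l, head N l) \<or> (x, y) = (head N l, tail N l)"
      by (auto simp: parcs_mk_symmetric N')
    then have "z $ x = z $ y"
      using laplacian_inner_eq_0[OF assms] by (auto simp: inner_diff_left inner_axis')
    with step show ?case
      by simp
  qed simp
qed

lemma laplacian_inj:
  assumes "z \<in> ones_perp" "M *v z = 0"
  shows "z = 0"
proof -
  have const: "z $ p = z $ q" for p q
    by (rule laplacian_kernel_constant) (simp add: assms(2))
  have "z $ p * real CARD('n) = 0" for p
  proof -
    have "(\<Sum>q\<in>UNIV. z $ q) = (\<Sum>q\<in>(UNIV :: 'n set). z $ p)"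
      by (intro sum.cong refl const)
    then show ?thesis
      using assms(1) by (simp add: mem_ones_perp inner_vec_def)
  qed
  then show ?thesis
    by (simp add: vec_eq_iff)
qed

lemma gradient_network_potential:
  assumes "smooth_on UNIV G"
  shows "gradient (\<lambda>w. network_potential N neg R G w k) z =
    M *v z - (k * deriv G (edge neg \<bullet> z)) *\<^sub>R edge neg"
proof -
  let ?D = "\<lambda>d. (M *v z - (k * deriv G (edge neg \<bullet> z)) *\<^sub>R edge neg) \<bullet> d"
  have "((\<lambda>w. G (edge neg \<bullet> w)) has_derivative (\<lambda>d. (edge neg \<bullet> d) * deriv G (edge neg \<bullet> z))) (at z)"
    by (rule DERIV_compose_FDERIV[where g = "\<lambda>z. edge neg \<bullet> z",
          OF smooth_on_has_real_derivative[OF assms UNIV_I]]) (auto intro!: derivative_eq_intros)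
  moreover have "((\<lambda>w. (edge l \<bullet> w)\<^sup>2) has_derivative (\<lambda>d. 2 * (edge l \<bullet> z) * (edge l \<bullet> d))) (at z)" for l
    by (auto intro!: derivative_eq_intros)
  ultimately have "((\<lambda>w. network_potential N neg R G w k) has_derivative
      (\<lambda>d. (\<Sum>l\<in>UNIV - {neg}. 1 / 2 * inverse (R l) * (2 * (edge l \<bullet> z) * (edge l \<bullet> d)))
        - k * ((edge neg \<bullet> d) * deriv G (edge neg \<bullet> z)))) (at z)"
    unfolding network_potential_def edge_voltages_eq
    by (intro has_derivative_diff has_derivative_sum has_derivative_mult_right)
  moreover have "(\<lambda>d. (\<Sum>l\<in>UNIV - {neg}. 1 / 2 * inverse (R l) * (2 * (edge l \<bullet> z) * (edge l \<bullet> d)))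
      - k * ((edge neg \<bullet> d) * deriv G (edge neg \<bullet> z))) = ?D"
    unfolding inner_diff_left[of "M *v z"] laplacian_inner by (simp add: mult_ac)
  ultimately have "((\<lambda>w. network_potential N neg R G w k) has_derivative ?D) (at z)"
    by simp
  then show ?thesis
    by (simp add: gradient_def frechet_derivative_eq vec_eq_iff inner_axis)
qed

lemma lyapunov_schmidt:
  assumes "smooth_on UNIV G" "deriv G 0 = 0" "deriv (deriv G) 0 = 1"
    and "v \<in> ones_perp" "M *v v = edge neg" "r = edge neg \<bullet> v"
  shows "lyapunov_schmidt (network_potential N neg R G) M (edge neg) v r (deriv G)"
proof
  \<comment> \<open>\<open>r\<close> is the energy of \<open>v\<close>, a sum of nonnegative terms.
    If it were 0, \<open>v\<close> would be constant and \<open>edge neg = M *v v\<close> would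
    vanish, which is impossible for an edge with distinct ends.\<close>
  have r: "r = (M *v v) \<bullet> v"
    by (simp add: assms(5,6))
  have "0 \<le> inverse (R l)" if "l \<noteq> neg" for l
    using R_pos[OF that] by simp
  then have "r \<ge> 0"
    unfolding r laplacian_inner mult.assoc
    by (intro sum_nonneg mult_nonneg_nonneg[OF _ zero_le_square]) auto
  moreover have "r \<noteq> 0"
  proof
    assume "r = 0"
    then have "v $ p = v $ q" for p q
      using laplacian_kernel_constant r by simp
    then have "edge l \<bullet> v = 0" for l
      by (simp add: inner_diff_left inner_axis')
    then have "edge neg = 0"
      using assms(5) unfolding laplacian_mult by simp
    moreover have "edge neg $ tail N neg = 1"
      using loopfree_digraph.no_loops[OF loopfree, of neg] arcs by (simp add: axis_def)
    ultimately show False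
      by simp
  qed
  ultimately show "r > 0"
    by simp
qed (use assms in \<open>simp_all add: gradient_network_potential laplacian_sym laplacian_perp edge_perp
      laplacian_inj smooth_on_deriv\<close>)

end

text \<open>The first conjunct supplies a reduction and the second treats every one, so the
  classification is neither vacuous nor tied to a particular \<open>W\<close>.\<close>

theorem corollary1:
  fixes N :: "('n::finite, 'm::finite) pre_digraph"
    and B C :: "'n set" and neg :: 'm and i j :: 'n
    and R :: "'m \<Rightarrow> real" and G :: "real \<Rightarrow> real"
    and v :: "real ^ 'n" and r :: real
  defines "K \<equiv> network_potential N neg R G"
    and "g \<equiv> deriv G"
  assumes "verts N = UNIV" and "arcs N = UNIV" and "loopfree_digraph N"
    and "tail N neg = i" and "head N neg = j"
    and "B \<union> C = UNIV" and "B \<inter> C = {}"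
    and "\<And>l. l \<noteq> neg \<Longrightarrow> R l > 0"
    and "convex_on UNIV G" and "smooth_on UNIV G"
    and "g 0 = 0" and "deriv g 0 = 1"
    and "Digraph_Component.connected (pre_digraph.del_arc N neg)"
    and "v \<in> ones_perp" and "laplacian_without N neg R *v v = axis i 1 - axis j 1"
    and "r = v $ i - v $ j"
    and "block_invertible C (hessian (\<lambda>z. K z (inverse r)) 0)"
  shows "(\<exists>W. LS_implicit_function K B v (inverse r) W) \<and>
    (\<forall>W. LS_implicit_function K B v (inverse r) W \<longrightarrow>
      (let h = bifurcation_germ K v (inverse r) W in
        (deriv (deriv g) 0 \<noteq> 0 \<longrightarrow> transcritical h) \<and>
        (deriv (deriv g) 0 = 0 \<and> deriv (deriv (deriv g)) 0 \<noteq> 0 \<longrightarrow>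
           pitchfork h \<and>
           (deriv (deriv (deriv g)) 0 < 0 \<longrightarrow> supercritical_pitchfork h) \<and>
           (deriv (deriv (deriv g)) 0 > 0 \<longrightarrow> subcritical_pitchfork h)) \<and>
        (deriv (deriv g) 0 = 0 \<and> deriv (deriv (deriv g)) 0 = 0 \<longrightarrow> germ_codim h > 2)))"
proof -
  interpret signed_network N neg R
    by (intro signed_network.intro assms)
  interpret lyapunov_schmidt K M "edge neg" v r g
    unfolding K_def g_def using assms
    by (intro lyapunov_schmidt) (simp_all add: inner_diff_left inner_axis')
  have "let h = bifurcation_germ K v (inverse r) W in
        (deriv (deriv g) 0 \<noteq> 0 \<longrightarrow> transcritical h) \<and>
        (deriv (deriv g) 0 = 0 \<and> deriv (deriv (deriv g)) 0 \<noteq> 0 \<longrightarrow>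
           pitchfork h \<and>
           (deriv (deriv (deriv g)) 0 < 0 \<longrightarrow> supercritical_pitchfork h) \<and>
           (deriv (deriv (deriv g)) 0 > 0 \<longrightarrow> subcritical_pitchfork h)) \<and>
        (deriv (deriv g) 0 = 0 \<and> deriv (deriv (deriv g)) 0 = 0 \<longrightarrow> germ_codim h > 2)"
    if W: "LS_implicit_function K B v (inverse r) W" for W
  proof -
    define h where "h = bifurcation_germ K v (inverse r) W"
    obtain s where "reduced_germ g s h r"
      using LS_reduced_germ[OF W] unfolding h_def by blast
    then interpret reduced_germ g s h r .
    have super: "supercritical_pitchfork h"
      if "deriv (deriv g) 0 = 0" "deriv (deriv (deriv g)) 0 < 0"
    proof -
      have "{m::real. - sgn (deriv (deriv (deriv g)) 0) * m > 0} = {0<..}"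
        using that(2) by auto
      then show ?thesis
        using pitchfork_h that unfolding supercritical_pitchfork_def by (metis less_irrefl)
    qed
    have sub: "subcritical_pitchfork h"
      if "deriv (deriv g) 0 = 0" "deriv (deriv (deriv g)) 0 > 0"
    proof -
      have "{m::real. - sgn (deriv (deriv (deriv g)) 0) * m > 0} = {..<0}"
        using that(2) by auto
      then show ?thesis
        using pitchfork_h that unfolding subcritical_pitchfork_def by (metis less_irrefl)
    qed
    show ?thesis
      unfolding h_def[symmetric] Let_def
      by (intro conjI impI; (elim conjE)?)
        (use transcritical_h pitchfork_h(1) super sub germ_codim_h in blast)+
  qed
  then show ?thesis
    using LS_implicit_function_exists by blast
qed

end
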